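(* Let $n\ge 2$ be an integer. For given $\alpha,\beta,m,M>0$, the absolute minimum of the action functional $\mathcal{A}$ on $$\Lambda=\Big\{q\in\mathcal{H}\ \Big|\ \int_0^{2\pi} q_i(t)\,dt=0,\ \ q_i(t)=q_1\big(t+(i-1)\tfrac{2\pi}{n}\big)\ \ \forall t\in\mathbb{R},\ i=1,2,\ldots,n\Big\}$$ is attained on a relative equilibrium motion $\tilde q(t)=(\tilde q_1(t),\ldots,\tilde q_n(t))$. Moreover, at every instant $t$, the points $\tilde q_1(t),\tilde q_2(t),\ldots,\tilde q_n(t)$ lie at the vertices of a regular $n$-gon centered at the origin and contained in the $yz$-plane $\{(x,y,z)\in\mathbb{R}^3: x=0\}$, and (for fixed $n,\alpha,\beta,M$) the circumradius of this regular $n$-gon increases as $m$ increases.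
   Context: Let $C_1=(1,0,0)$ and $C_2=(-1,0,0)$ in $\mathbb{R}^3$ (positions of two fixed centers of mass $M$). For $q=(q_1,\ldots,q_n)\in(\mathbb{R}^{3})^n$ (positions of $n$ moving particles of mass $m$) put $$V(q_1,\ldots,q_n)=\sum_{1\le i<j\le n}\frac{m^2}{|q_i-q_j|^{\alpha}}+\sum_{i=1}^n\Big(\frac{mM}{|q_i-C_1|^{\beta}}+\frac{mM}{|q_i-C_2|^{\beta}}\Big).$$ $H^1_{2\pi}(\mathbb{R},\mathbb{R}^{d})$ denotes the Sobolev space of $2\pi$-periodic functions $\mathbb{R}\to\mathbb{R}^d$ that are, together with their weak derivative, square integrable on $[0,2\pi]$ (identified with their continuous representatives). The set of collision-free loops is $$\mathcal{H}=\{q\in H^1_{2\pi}(\mathbb{R},\mathbb{R}^{3n}) \mid q_i(t)\ne q_j(t)\ \forall i\neq j,\ \forall t\in\mathbb{R};\ q_k(t)\ne C_1,\ q_k(t)\neq C_2,\ k=1,\ldots,n,\ \forall t\in\mathbb{R}\},$$ and the action functional on $\mathcal{H}$ is $$\mathcal{A}(q)=\int_0^{2\pi}\Big[\frac m2\sum_{i=1}^n|\dot q_i(t)|^2+V(q_1(t),\ldots,q_n(t))\Big]dt .$$ A relative equilibrium motion (associated with the regular polygon) is a motion in which the $n$ particles lie at the vertices of a regular $n$-gon and perform a uniform circular motion around the center of this $n$-gon. For $n=2$, the vertices of a regular $2$-gon are two distinct points symmetric with respect to its center. *)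

theory Defs
  imports "HOL-Analysis.Analysis"
begin

type_synonym point = "real ^ 3"

definition C1 :: point where "C1 = vector [1, 0, 0]"
definition C2 :: point where "C2 = vector [- 1, 0, 0]"

definition periodic :: "(real \<Rightarrow> 'a) \<Rightarrow> bool" where
  "periodic u \<longleftrightarrow> (\<forall>t. u (t + 2 * pi) = u t)"

definition square_integrable :: "(real \<Rightarrow> 'a::euclidean_space) \<Rightarrow> bool" where
  "square_integrable u \<longleftrightarrow> u \<in> borel_measurable lborel
     \<and> set_integrable lborel {0..2 * pi} (\<lambda>t. (norm (u t))\<^sup>2)"

definition test_function :: "(real \<Rightarrow> real) \<Rightarrow> bool" where
  "test_function \<phi> \<longleftrightarrow> periodic \<phi> \<and> (\<forall>k. (deriv ^^ k) \<phi> differentiable_on UNIV)"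

text \<open>Weak derivative on the circle, by integration by parts against all smooth
  \<open>2\<pi>\<close>-periodic functions (the usual definition for spaces of periodic functions, as in
  Mawhin and Willem's book on critical point theory). A square integrable function has at most
  one square integrable weak derivative up to null sets.\<close>

definition has_weak_derivative ::
    "(real \<Rightarrow> 'a::euclidean_space) \<Rightarrow> (real \<Rightarrow> 'a) \<Rightarrow> bool" where
  "has_weak_derivative u v \<longleftrightarrow> periodic v \<and>
     (\<forall>\<phi>. test_function \<phi> \<longrightarrow>
        (LINT t:{0..2 * pi}|lborel. deriv \<phi> t *\<^sub>R u t)
          = - (LINT t:{0..2 * pi}|lborel. \<phi> t *\<^sub>R v t))"

text \<open>Elements of the Sobolev space are represented by their continuous representatives.\<close>

definition H1 :: "(real \<Rightarrow> 'a::euclidean_space) set" where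
  "H1 = {u. periodic u \<and> continuous_on UNIV u \<and> square_integrable u \<and>
     (\<exists>v. square_integrable v \<and> has_weak_derivative u v)}"

definition weak_deriv :: "(real \<Rightarrow> 'a::euclidean_space) \<Rightarrow> real \<Rightarrow> 'a" where
  "weak_deriv u = (SOME v. square_integrable v \<and> has_weak_derivative u v)"

text \<open>A configuration of \<open>n\<close> particles is a function \<open>nat \<Rightarrow> point\<close>, and a loop of configurations
  a function \<open>nat \<Rightarrow> real \<Rightarrow> point\<close>; only the indices \<open>1, \<dots>, n\<close> matter. A map into
  \<open>(\<real>\<^sup>3)\<^sup>n\<close> is of Sobolev class iff each of its \<open>n\<close> components is.\<close>

definition V :: "nat \<Rightarrow> real \<Rightarrow> real \<Rightarrow> real \<Rightarrow> real \<Rightarrow> (nat \<Rightarrow> point) \<Rightarrow> real" where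
  "V n \<alpha> \<beta> m M x =
     (\<Sum>(i, j) \<in> {(i, j). 1 \<le> i \<and> i < j \<and> j \<le> n}. m\<^sup>2 / norm (x i - x j) powr \<alpha>)
     + (\<Sum>i = 1..n. m * M / norm (x i - C1) powr \<beta> + m * M / norm (x i - C2) powr \<beta>)"

definition collision_free_loops :: "nat \<Rightarrow> (nat \<Rightarrow> real \<Rightarrow> point) set" where
  "collision_free_loops n = {q.
     (\<forall>i\<in>{1..n}. q i \<in> H1) \<and>
     (\<forall>i\<in>{1..n}. \<forall>j\<in>{1..n}. i \<noteq> j \<longrightarrow> (\<forall>t. q i t \<noteq> q j t)) \<and>
     (\<forall>k\<in>{1..n}. \<forall>t. q k t \<noteq> C1 \<and> q k t \<noteq> C2)}"

definition action ::
    "nat \<Rightarrow> real \<Rightarrow> real \<Rightarrow> real \<Rightarrow> real \<Rightarrow> (nat \<Rightarrow> real \<Rightarrow> point) \<Rightarrow> real" where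
  "action n \<alpha> \<beta> m M q = (LINT t:{0..2 * pi}|lborel.
     m / 2 * (\<Sum>i = 1..n. (norm (weak_deriv (q i) t))\<^sup>2) + V n \<alpha> \<beta> m M (\<lambda>i. q i t))"

definition Lam :: "nat \<Rightarrow> (nat \<Rightarrow> real \<Rightarrow> point) set" where
  "Lam n = {q \<in> collision_free_loops n. \<forall>i\<in>{1..n}.
     (LINT t:{0..2 * pi}|lborel. q i t) = 0 \<and>
     (\<forall>t. q i t = q 1 (t + (real i - 1) * (2 * pi / real n)))}"

definition is_minimizer ::
    "nat \<Rightarrow> real \<Rightarrow> real \<Rightarrow> real \<Rightarrow> real \<Rightarrow> (nat \<Rightarrow> real \<Rightarrow> point) \<Rightarrow> bool" where
  "is_minimizer n \<alpha> \<beta> m M q \<longleftrightarrow>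
     q \<in> Lam n \<and> (\<forall>p \<in> Lam n. action n \<alpha> \<beta> m M q \<le> action n \<alpha> \<beta> m M p)"

definition orthonormal_pair :: "point \<Rightarrow> point \<Rightarrow> bool" where
  "orthonormal_pair u v \<longleftrightarrow> norm u = 1 \<and> norm v = 1 \<and> u \<bullet> v = 0"

text \<open>The set of vertices is a regular \<open>n\<close>-gon with center \<open>c\<close> and circumradius \<open>R\<close>. For \<open>n = 2\<close>
  these are the two points \<open>c + R u\<close> and \<open>c - R u\<close>, and \<open>v\<close> is irrelevant.\<close>

definition regular_ngon :: "nat \<Rightarrow> point \<Rightarrow> real \<Rightarrow> point set \<Rightarrow> bool" where
  "regular_ngon n c R P \<longleftrightarrow> R > 0 \<and> (\<exists>u v. orthonormal_pair u v \<and>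
     P = (\<lambda>k. c + R *\<^sub>R (cos (2 * pi * real k / real n) *\<^sub>R u
                        + sin (2 * pi * real k / real n) *\<^sub>R v)) ` {..<n})"

text \<open>All particles rotate in a common plane, spanned by \<open>u\<close> and \<open>v\<close>, about the fixed center \<open>c\<close>
  with a common nonzero angular velocity, and occupy all \<open>n\<close> vertices of a regular \<open>n\<close>-gon
  at every instant.\<close>

definition relative_equilibrium :: "nat \<Rightarrow> (nat \<Rightarrow> real \<Rightarrow> point) \<Rightarrow> bool" where
  "relative_equilibrium n q \<longleftrightarrow> (\<exists>c R u v \<omega> \<theta>. orthonormal_pair u v \<and> \<omega> \<noteq> 0 \<and>
     (\<forall>i\<in>{1..n}. \<forall>t. q i t = c + R *\<^sub>R (cos (\<omega> * t + \<theta> i) *\<^sub>R u + sin (\<omega> * t + \<theta> i) *\<^sub>R v)) \<and>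
     (\<forall>t. regular_ngon n c R ((\<lambda>i. q i t) ` {1..n})))"

definition yz_plane :: "point set" where
  "yz_plane = {x. x $ 1 = 0}"

text \<open>Radius \<open>R\<close> does not depend on the time \<open>t\<close>.\<close>

definition centered_yz_ngon_motion :: "nat \<Rightarrow> real \<Rightarrow> (nat \<Rightarrow> real \<Rightarrow> point) \<Rightarrow> bool" where
  "centered_yz_ngon_motion n R q \<longleftrightarrow>
     (\<forall>t. regular_ngon n 0 R ((\<lambda>i. q i t) ` {1..n}) \<and> (\<lambda>i. q i t) ` {1..n} \<subseteq> yz_plane)"

end

theory Submission imports Defs begin

text \<open>Let \<open>K\<close> be the integral of \<open>|q\<^sub>i'|\<^sup>2\<close> over a period for a loop \<open>q\<close> in \<open>\<Lambda>\<close>, and put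
  \<open>K = 2 \<pi> r\<^sup>2\<close>. Comparing Fourier coefficients, and using \<open>|sin (k x)| \<le> k |sin x|\<close>, the integral
  of \<open>|q\<^sub>1 (t + h) - q\<^sub>1 t|\<^sup>2\<close> is at most \<open>4 sin\<^sup>2 (h / 2) K\<close>; by Wirtinger's inequality the integral
  of \<open>|q\<^sub>i|\<^sup>2\<close> is at most \<open>K\<close>, and since \<open>q\<^sub>i\<close> has mean zero the integral of \<open>|q\<^sub>i - C|\<^sup>2\<close> exceeds it by
  exactly \<open>2 \<pi>\<close> for both centers \<open>C\<close>. Jensen's inequality for the convex function \<open>x \<mapsto> x powr - g\<close> turns these
  bounds into a lower bound of the potential energy by its value at the regular \<open>n\<close>-gon
  of radius \<open>r\<close> rotating in the \<open>yz\<close>-plane, for which all the inequalities are equalities. So the minimum of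
  the action is the minimum over \<open>r > 0\<close> of a function of one variable. A minimizer of constant norm \<open>R\<close> has
  \<open>r = R\<close>, because the bound is strictly decreasing in the integral of \<open>|q\<^sub>i|\<^sup>2\<close>. Finally, divided by \<open>m\<close> the
  function of \<open>r\<close> depends on \<open>m\<close> only through a term \<open>m S r powr - \<alpha>\<close> with \<open>S > 0\<close>, hence its
  minimizers increase strictly with \<open>m\<close>.\<close>

section \<open>Integration over one period\<close>

lemma periodic_shift:
  assumes "periodic f"
  shows "periodic (\<lambda>t. f (t + a))"
  unfolding periodic_def
proof
  fix t
  have "f (t + 2 * pi + a) = f ((t + a) + 2 * pi)" by (simp add: algebra_simps)
  then show "f (t + 2 * pi + a) = f (t + a)" using assms by (simp add: periodic_def)
qed

text \<open>On this finite measure space set integrals over a period become ordinary Bochner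
  integrals, to which the integration rules apply directly.\<close>

abbreviation circ :: "real measure" where
  "circ \<equiv> restrict_space lborel {0..2 * pi}"

lemma LINT_circ:
  fixes f :: "real \<Rightarrow> 'a::euclidean_space"
  shows "(LINT t:{0..2 * pi}|lborel. f t) = integral\<^sup>L circ f"
  by (simp add: set_lebesgue_integral_def integral_restrict_space)

lemma set_integrable_circ:
  fixes f :: "real \<Rightarrow> 'a::euclidean_space"
  shows "set_integrable lborel {0..2 * pi} f \<longleftrightarrow> integrable circ f"
  by (simp add: set_integrable_def integrable_restrict_space)

lemma measurable_circ [measurable (raw)]:
  "f \<in> borel_measurable borel \<Longrightarrow> f \<in> borel_measurable circ"
  by (simp add: measurable_restrict_space1)

lemma integrable_circ_continuous:
  fixes f :: "real \<Rightarrow> 'a::euclidean_space"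
  assumes "continuous_on UNIV f"
  shows "integrable circ f"
  using assms borel_integrable_atLeastAtMost'[of 0 "2 * pi" f] continuous_on_subset
  by (fastforce simp: set_integrable_circ[symmetric])

lemma measure_circ [simp]: "measure circ {0..2 * pi} = 2 * pi"
  by (simp add: measure_restrict_space)

lemma integral_circ_const [simp]:
  fixes c :: "'a::euclidean_space"
  shows "integral\<^sup>L circ (\<lambda>_. c) = (2 * pi) *\<^sub>R c"
  by simp

lemma integral_circ_eq_integral:
  fixes f :: "real \<Rightarrow> 'a::euclidean_space"
  assumes "continuous_on UNIV f"
  shows "integral\<^sup>L circ f = integral {0..2 * pi} f"
  using set_borel_integral_eq_integral(2)[of "{0..2*pi}" f] integrable_circ_continuous[OF assms]
  by (simp add: set_integrable_circ LINT_circ)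

text \<open>The boundary values of a periodic antiderivative cancel. Orthogonality of the Hartley
  functions, integration by parts and the zero mean of circular motions all rest on this.\<close>

lemma integral_circ_periodic_deriv:
  fixes F :: "real \<Rightarrow> 'a::euclidean_space"
  assumes "\<And>t. (F has_vector_derivative f t) (at t)" "continuous_on UNIV f" "periodic F"
  shows "integral\<^sup>L circ f = 0"
proof -
  have "(f has_integral (F (2 * pi) - F 0)) {0..2 * pi}"
    by (rule fundamental_theorem_of_calculus) (auto intro: has_vector_derivative_at_within assms(1))
  moreover have "F (2 * pi) = F 0"
    using assms(3) by (metis add_0 periodic_def)
  ultimately show ?thesis
    using integral_circ_eq_integral[OF assms(2)] by (auto dest: integral_unique)
qed

lemma integral_circ_shift:
  fixes f :: "real \<Rightarrow> 'a::euclidean_space"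
  assumes "continuous_on UNIV f" "periodic f"
  shows "integral\<^sup>L circ (\<lambda>t. f (t + s)) = integral\<^sup>L circ f"
proof -
  \<comment> \<open>an antiderivative on the whole line; the integral over an interval with reversed ends is zero\<close>
  define F where "F x = integral {0..x} f - integral {x..0} f" for x
  have int: "f integrable_on {a..b}" for a b
    by (meson assms(1) continuous_on_subset integrable_continuous_interval subset_UNIV)
  have F: "(F has_vector_derivative f x) (at x)" for x
  proof -
    \<comment> \<open>The margin of \<open>1\<close> puts \<open>0\<close> and \<open>x\<close> in
      the interior of the interval, so the derivative within it becomes a derivative on the
      line.\<close>
    define a where "a = min 0 x - 1"
    define b where "b = max 0 x + 1"
    have x: "x \<in> {a..b}" by (auto simp: a_def b_def min_def max_def)
    have E: "integral {a..y} f - integral {a..0} f = F y" if "y \<in> {a..b}" for y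
    proof (cases "0 \<le> y")
      case True
      then show ?thesis
        using Henstock_Kurzweil_Integration.integral_combine[of a 0 y f] int
        by (cases "y = 0") (auto simp: F_def a_def algebra_simps)
    next
      case False
      then show ?thesis
        using Henstock_Kurzweil_Integration.integral_combine[of a y 0 f] int that
        by (auto simp: F_def algebra_simps)
    qed
    have "((\<lambda>y. integral {a..y} f) has_vector_derivative f x) (at x within {a..b})"
      by (rule integral_has_vector_derivative)
        (use assms(1) continuous_on_subset in \<open>auto simp: a_def b_def\<close>)
    then have "((\<lambda>y. integral {a..y} f - integral {a..0} f) has_vector_derivative f x) (at x within {a..b})"
      by (auto intro!: derivative_eq_intros)
    then have "(F has_vector_derivative f x) (at x within {a..b})"
      by (rule has_vector_derivative_transform[rotated 2]) (use x in \<open>simp_all add: E\<close>)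
    then show ?thesis
      by (subst (asm) at_within_interior) (auto simp: a_def b_def)
  qed
  have Fs: "((\<lambda>t. F (t + s)) has_vector_derivative f (t + s)) (at t)" for s t
  proof -
    have "((\<lambda>t. t + s) has_vector_derivative 1) (at t)"
      by (auto intro!: derivative_eq_intros)
    from vector_diff_chain_at[OF this F] show ?thesis
      by (simp add: o_def)
  qed
  have sh: "integral\<^sup>L circ (\<lambda>t. f (t + s)) = F (2 * pi + s) - F s" for s
  proof -
    have "((\<lambda>t. f (t + s)) has_integral (F (2 * pi + s) - F (0 + s))) {0..2 * pi}"
    proof (rule fundamental_theorem_of_calculus)
      show "((\<lambda>t. F (t + s)) has_vector_derivative f (t + s)) (at t within {0..2*pi})" for t
        by (rule has_vector_derivative_at_within[OF Fs])
    qed simp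
    moreover have "continuous_on UNIV (\<lambda>t. f (t + s))"
      by (intro continuous_on_compose2[OF assms(1)] continuous_intros) auto
    ultimately show ?thesis
      using integral_circ_eq_integral by (metis add_0 integral_unique)
  qed
  \<comment> \<open>By periodicity of \<open>f\<close> the increment of \<open>F\<close> over one
    period has derivative zero in its starting point, hence every shift has the same
    integral.\<close>
  have "\<exists>c. \<forall>x\<in>UNIV. F (2 * pi + x) - F x = c"
  proof (rule has_vector_derivative_zero_constant)
    show "convex (UNIV :: real set)" by simp
    fix x
    have "((\<lambda>t. F (2 * pi + t)) has_vector_derivative f (2 * pi + x)) (at x)"
      using Fs[of "2 * pi" x] by (simp add: add.commute)
    moreover have "f (2 * pi + x) = f x"
      using assms(2) by (simp add: periodic_def add.commute)
    ultimately show "((\<lambda>x. F (2 * pi + x) - F x) has_vector_derivative 0) (at x within UNIV)"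
      using F[of x] by (auto intro!: derivative_eq_intros)
  qed blast
  then have "F (2 * pi + s) - F s = F (2 * pi + 0) - F 0"
    by (metis UNIV_I)
  then show ?thesis
    using sh[of s] sh[of 0] by simp
qed

section \<open>Square integrable real functions on a period\<close>

definition L2 :: "(real \<Rightarrow> real) \<Rightarrow> bool" where
  "L2 f \<longleftrightarrow> f \<in> borel_measurable circ \<and> integrable circ (\<lambda>t. (f t)\<^sup>2)"

lemma L2_continuous: "continuous_on UNIV f \<Longrightarrow> L2 f"
  by (auto simp: L2_def borel_measurable_continuous_onI intro!: measurable_circ integrable_circ_continuous continuous_intros)

lemma integrable_L2_mult:
  assumes "L2 f" "L2 g"
  shows "integrable circ (\<lambda>t. f t * g t)"
proof (rule Bochner_Integration.integrable_bound)
  show "integrable circ (\<lambda>t. (f t)\<^sup>2 + (g t)\<^sup>2)"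
    using assms by (auto simp: L2_def)
  show "(\<lambda>t. f t * g t) \<in> borel_measurable circ"
    using assms by (auto simp: L2_def)
  have "\<bar>x * y\<bar> \<le> x\<^sup>2 + y\<^sup>2" for x y :: real
  proof -
    have "2 * \<bar>x * y\<bar> \<le> x\<^sup>2 + y\<^sup>2"
      using sum_squares_bound[of "\<bar>x\<bar>" "\<bar>y\<bar>"] by (simp add: abs_mult)
    then show ?thesis by (smt (verit))
  qed
  then show "AE t in circ. norm (f t * g t) \<le> norm ((f t)\<^sup>2 + (g t)\<^sup>2)"
    by simp
qed

lemma L2_add: "L2 f \<Longrightarrow> L2 g \<Longrightarrow> L2 (\<lambda>t. f t + g t)"
  using integrable_L2_mult[of f g] by (auto simp: L2_def power2_sum mult.assoc)

lemma L2_cmult: "L2 f \<Longrightarrow> L2 (\<lambda>t. c * f t)"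
  by (auto simp: L2_def power_mult_distrib)

lemma L2_diff: "L2 f \<Longrightarrow> L2 g \<Longrightarrow> L2 (\<lambda>t. f t - g t)"
  using L2_add[of f "\<lambda>t. -1 * g t"] L2_cmult[of g "-1"] by simp

lemma L2_const: "L2 (\<lambda>_. c)"
  by (rule L2_continuous) simp

lemma L2_sum: "(\<And>i. i \<in> A \<Longrightarrow> L2 (f i)) \<Longrightarrow> L2 (\<lambda>t. \<Sum>i\<in>A. f i t)"
proof (induction A rule: infinite_finite_induct)
  case (insert x A)
  then show ?case by (simp add: L2_add)
qed (auto simp: L2_const)

lemma L2_imp_integrable: "L2 f \<Longrightarrow> integrable circ f"
  using integrable_L2_mult[of f "\<lambda>_. 1"] L2_const[of 1] by simp

section \<open>Fourier series\<close>

text \<open>The Hartley functions \<open>cos (j t) + sin (j t)\<close>, \<open>j \<in> \<int>\<close>, form a real orthogonal system in which all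
  elements have the same norm and differentiation is \<open>j \<mapsto> - j\<close> up to a factor. Sines and cosines
  would need a case distinction at each step.\<close>

definition hart :: "int \<Rightarrow> real \<Rightarrow> real" where
  "hart j t = cos (of_int j * t) + sin (of_int j * t)"

lemma continuous_on_hart [continuous_intros]: "continuous_on S (hart j)"
  unfolding hart_def by (intro continuous_intros)

lemma L2_hart: "L2 (hart j)"
  by (intro L2_continuous continuous_intros)

lemma cos_int_2pi: "cos (of_int j * (t + 2 * pi)) = cos (of_int j * t)"
  using cos.plus_of_int[of "of_int j * t" j] by (simp add: algebra_simps)

lemma sin_int_2pi: "sin (of_int j * (t + 2 * pi)) = sin (of_int j * t)"
  using sin.plus_of_int[of "of_int j * t" j] by (simp add: algebra_simps)

lemma periodic_hart: "periodic (hart j)"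
  unfolding periodic_def hart_def by (simp only: cos_int_2pi sin_int_2pi) simp

lemma hart_has_derivative:
  "(hart j has_real_derivative of_int j * hart (- j) t) (at t)"
  unfolding hart_def by (auto intro!: derivative_eq_intros simp: algebra_simps)

text \<open>The product is \<open>cos ((j - k) t) + sin ((j + k) t)\<close>, and cosine and sine are
  the even and odd parts of a Hartley function. So products stay in the linear span.\<close>

lemma hart_mult:
  "hart j t * hart k t = 1/2 * hart (j - k) t + 1/2 * hart (k - j) t + 1/2 * hart (j + k) t + (-1/2) * hart (- j - k) t"
proof -
  have "hart j t * hart k t = cos (of_int j * t - of_int k * t) + sin (of_int j * t + of_int k * t)"
    by (simp add: hart_def cos_diff sin_add algebra_simps)
  moreover have "of_int j * t - of_int k * t = of_int (j - k) * t" "of_int j * t + of_int k * t = of_int (j + k) * t"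
    by (simp_all add: algebra_simps)
  moreover have "of_int (k - j) * t = - (of_int (j - k) * t)" "of_int (- j - k) * t = - (of_int (j + k) * t)"
    by (simp_all add: algebra_simps)
  ultimately show ?thesis
    unfolding hart_def by (simp only: cos_minus sin_minus)  (simp add: field_simps)
qed

lemma hart_diff_arg:
  "hart j (t - h) = cos (of_int j * h) * hart j t - sin (of_int j * h) * hart (- j) t"
  by (simp add: hart_def right_diff_distrib cos_diff sin_diff) (simp add: algebra_simps)

lemma integral_hart: "integral\<^sup>L circ (hart j) = (if j = 0 then 2 * pi else 0)"
proof (cases "j = 0")
  case True
  then show ?thesis by (simp add: hart_def[abs_def])
next
  case False
  have "integral\<^sup>L circ (hart j) = 0"
  proof (rule integral_circ_periodic_deriv)
    show "((\<lambda>t. - hart (- j) t / of_int j) has_vector_derivative hart j t) (at t)" for t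
      using False hart_has_derivative[of "-j" t]
      by (auto simp: has_real_derivative_iff_has_vector_derivative[symmetric] intro!: derivative_eq_intros)
  qed (use periodic_hart[of "-j"] in \<open>auto intro: continuous_on_hart simp: periodic_def\<close>)
  then show ?thesis using False by simp
qed

text \<open>Not normalized: \<open>hart j\<close> has square norm \<open>2 * pi\<close>, so the
  factor of \<open>hart j\<close> in the Fourier series is
  \<open>coef f j / (2 * pi)\<close>.\<close>

definition coef :: "(real \<Rightarrow> real) \<Rightarrow> int \<Rightarrow> real" where
  "coef f j = (LINT t|circ. f t * hart j t)"

text \<open>In \<open>hart_mult\<close> the first two terms have mean \<open>1/2\<close> each if
  \<open>j = k\<close>. The last two cancel after integration, also for \<open>j = - k\<close>,
  because of their opposite signs.\<close>

lemma coef_hart: "coef (hart j) k = (if j = k then 2 * pi else 0)"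
proof -
  have "integrable circ (hart i)" for i
    by (intro L2_imp_integrable L2_hart)
  then show ?thesis
    unfolding coef_def hart_mult by (simp add: integral_hart)
qed

lemma coef_diff: "L2 f \<Longrightarrow> L2 g \<Longrightarrow> coef (\<lambda>t. f t - g t) j = coef f j - coef g j"
  unfolding coef_def by (simp add: left_diff_distrib integrable_L2_mult L2_hart)

lemma coef_cmult: "coef (\<lambda>t. c * f t) j = c * coef f j"
  unfolding coef_def by (simp add: mult.assoc)

lemma coef_sum: "(\<And>i. i \<in> A \<Longrightarrow> L2 (f i)) \<Longrightarrow> coef (\<lambda>t. \<Sum>i\<in>A. f i t) j = (\<Sum>i\<in>A. coef (f i) j)"
  unfolding coef_def sum_distrib_right
  by (rule Bochner_Integration.integral_sum) (auto intro: integrable_L2_mult L2_hart)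

definition partial_sum :: "(real \<Rightarrow> real) \<Rightarrow> nat \<Rightarrow> real \<Rightarrow> real" where
  "partial_sum f N t = (\<Sum>j\<in>{- int N..int N}. coef f j / (2 * pi) * hart j t)"

lemma L2_partial_sum: "L2 (partial_sum f N)"
  unfolding partial_sum_def by (intro L2_sum L2_cmult L2_hart)

lemma coef_partial_sum:
  "coef (partial_sum f N) k = (if k \<in> {- int N..int N} then coef f k else 0)"
proof -
  have *: "coef (\<lambda>t. \<Sum>j\<in>A. d j * hart j t) k = (if k \<in> A then 2 * pi * d k else 0)"
    if "finite A" for A and d :: "int \<Rightarrow> real"
    using that by (subst coef_sum) (auto simp: coef_cmult coef_hart L2_cmult L2_hart if_distrib cong: if_cong)
  show ?thesis
    unfolding partial_sum_def by (subst *) auto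
qed

lemma integral_mult_partial_sum:
  assumes "L2 g"
  shows "(LINT t|circ. g t * partial_sum f N t) = (\<Sum>j\<in>{- int N..int N}. coef f j * coef g j) / (2 * pi)"
proof -
  have *: "(LINT t|circ. (\<Sum>j\<in>A. d j * (g t * hart j t))) = (\<Sum>j\<in>A. d j * coef g j)"
    for A and d :: "int \<Rightarrow> real"
    by (subst Bochner_Integration.integral_sum)
      (auto intro!: integrable_L2_mult L2_hart assms simp: coef_def)
  have "g t * partial_sum f N t = (\<Sum>j\<in>{- int N..int N}. coef f j / (2 * pi) * (g t * hart j t))" for t
    unfolding partial_sum_def sum_distrib_left by (rule sum.cong) auto
  then show ?thesis
    by (simp only: *) (simp add: sum_divide_distrib)
qed

text \<open>Pythagoras: the partial sum is an orthogonal projection, so its products with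
  \<open>f\<close> and with itself have the same integral.\<close>

lemma integral_square_partial_sum:
  assumes "L2 f"
  shows "(LINT t|circ. (f t)\<^sup>2) = (\<Sum>j\<in>{- int N..int N}. (coef f j)\<^sup>2) / (2 * pi)
           + (LINT t|circ. (f t - partial_sum f N t)\<^sup>2)"
proof -
  let ?S = "partial_sum f N"
  have 1: "(LINT t|circ. f t * ?S t) = (\<Sum>j\<in>{- int N..int N}. (coef f j)\<^sup>2) / (2 * pi)"
    by (simp add: integral_mult_partial_sum assms power2_eq_square)
  have 2: "(LINT t|circ. ?S t * ?S t) = (\<Sum>j\<in>{- int N..int N}. (coef f j)\<^sup>2) / (2 * pi)"
    by (simp add: integral_mult_partial_sum L2_partial_sum coef_partial_sum power2_eq_square)
  have "(LINT t|circ. (f t - ?S t)\<^sup>2)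
      = (LINT t|circ. f t * f t - 2 * (f t * ?S t) + ?S t * ?S t)"
    by (simp add: power2_eq_square algebra_simps)
  also have "\<dots> = (LINT t|circ. f t * f t) - 2 * (LINT t|circ. f t * ?S t) + (LINT t|circ. ?S t * ?S t)"
    using assms L2_partial_sum[of f N] by (simp add: integrable_L2_mult)
  finally show ?thesis
    using 1 2 by (simp add: power2_eq_square)
qed

lemma Bessel_inequality:
  assumes "L2 f"
  shows "(\<Sum>j\<in>{- int N..int N}. (coef f j)\<^sup>2) / (2 * pi) \<le> (LINT t|circ. (f t)\<^sup>2)"
  unfolding integral_square_partial_sum[OF assms, of N] by simp

section \<open>Density of trigonometric polynomials and Parseval's bound\<close>

inductive trig_poly :: "(real \<Rightarrow> real) \<Rightarrow> bool" where
  hart: "trig_poly (\<lambda>t. c * hart j t)"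
| add: "trig_poly f \<Longrightarrow> trig_poly g \<Longrightarrow> trig_poly (\<lambda>t. f t + g t)"

lemma L2_trig_poly: "trig_poly f \<Longrightarrow> L2 f"
  by (induction rule: trig_poly.induct) (auto intro: L2_cmult L2_hart L2_add)

lemma trig_poly_cmult: "trig_poly f \<Longrightarrow> trig_poly (\<lambda>t. c * f t)"
proof (induction rule: trig_poly.induct)
  case (hart d j)
  then show ?case using trig_poly.hart[of "c * d" j] by (simp add: mult.assoc)
next
  case (add f g)
  then show ?case using trig_poly.add by (fastforce simp: distrib_left)
qed

lemma trig_poly_mult_hart: "trig_poly f \<Longrightarrow> trig_poly (\<lambda>t. f t * hart k t)"
proof (induction rule: trig_poly.induct)
  case (hart d j)
  have "trig_poly (\<lambda>t. hart j t * hart k t)"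
    unfolding hart_mult by (intro trig_poly.intros)
  then show ?case using trig_poly_cmult[of _ d] by (fastforce simp: mult.assoc)
next
  case (add f g)
  then show ?case using trig_poly.add by (fastforce simp: distrib_right)
qed

lemma trig_poly_mult: "trig_poly g \<Longrightarrow> trig_poly f \<Longrightarrow> trig_poly (\<lambda>t. f t * g t)"
proof (induction rule: trig_poly.induct)
  case (hart d j)
  then show ?case using trig_poly_cmult[OF trig_poly_mult_hart[OF hart], of d j] by (simp add: algebra_simps)
next
  case (add f g)
  then show ?case using trig_poly.add by (fastforce simp: distrib_left)
qed

lemma trig_poly_const: "trig_poly (\<lambda>_. c)"
  using trig_poly.hart[of c 0] by (simp add: hart_def)

lemma trig_poly_cos: "trig_poly cos" and trig_poly_sin: "trig_poly sin"
proof -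
  have "trig_poly (\<lambda>t. 1/2 * hart 1 t + c * hart (-1) t)" for c
    by (intro trig_poly.intros)
  moreover have "(\<lambda>t. 1/2 * hart 1 t + 1/2 * hart (-1) t) = cos"
    "(\<lambda>t. 1/2 * hart 1 t + (-1/2) * hart (-1) t) = sin"
    by (auto simp: hart_def field_simps fun_eq_iff)
  ultimately show "trig_poly cos" "trig_poly sin"
    by metis+
qed

text \<open>Stone-Weierstrass yields polynomials in the real coordinates of the plane. On the unit
  circle these coordinates are \<open>cos\<close> and \<open>sin\<close>, and trigonometric
  polynomials form an algebra.\<close>

lemma trig_poly_real_polynomial:
  fixes g :: "complex \<Rightarrow> real"
  assumes "real_polynomial_function g"
  shows "trig_poly (\<lambda>t. g (cis t))"
  using assms
proof induction
  case (linear f)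
  have "f (cis t) = f 1 * cos t + f \<i> * sin t" for t
  proof -
    have "cis t = cos t *\<^sub>R 1 + sin t *\<^sub>R \<i>"
      by (simp add: complex_eq_iff)
    then show ?thesis
      using linear by (simp add: linear_add linear_scale bounded_linear.linear)
  qed
  then show ?case
    by (simp add: trig_poly.add trig_poly_cmult trig_poly_cos trig_poly_sin)
qed (auto intro: trig_poly_const trig_poly.add trig_poly_mult)

text \<open>The two arguments differ by \<open>0\<close> or \<open>2 * pi\<close>, but their branch
  cuts are opposite half-axes. This allows passing from one to the other near a cut.\<close>

lemma periodic_Arg2pi: 
  assumes "periodic f" "z \<noteq> 0"
  shows "f (Arg2pi z) = f (Arg z)"
proof (cases "Arg z < 0")
  case True
  have "exp (\<i> * complex_of_real (Arg z + 2 * pi)) = exp (\<i> * complex_of_real (Arg z))"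
    by (auto simp: exp_eq algebra_simps intro!: exI[of _ 1])
  then have "Arg2pi z = Arg z + 2 * pi"
    by (intro Arg2pi_unique[of "norm z"])
      (use assms Arg_bounded[of z] True Arg_eq[of z] in auto)
  then show ?thesis using assms by (simp add: periodic_def)
next
  case False
  have "Arg2pi z = Arg z"
    by (rule Arg2pi_unique[of "norm z"])
      (use assms Arg_bounded[of z] False Arg_eq[of z] in \<open>auto simp: distrib_left exp_add\<close>)
  then show ?thesis by simp
qed

lemma periodic_plus_int: "periodic f \<Longrightarrow> f (t + 2 * pi * of_int k) = f t"
proof (induction k arbitrary: t rule: int_induct[where k=0])
  case (step1 i)
  from step1(2)[OF step1(3), of "t + 2 * pi"] step1(3) show ?case
    by (simp add: periodic_def algebra_simps)
next
  case (step2 i)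
  then have "f (t + 2 * pi * of_int (i - 1)) = f (t + 2 * pi * of_int (i - 1) + 2 * pi)"
    by (simp add: periodic_def)
  with step2 show ?case by (simp add: algebra_simps)
qed simp

text \<open>A periodic continuous function is a continuous function \<open>F\<close> on the unit
  circle, where Stone-Weierstrass applies.\<close>

lemma trig_poly_dense:
  assumes "continuous_on UNIV f" "periodic f" "0 < e"
  shows "\<exists>P. trig_poly P \<and> (\<forall>t. \<bar>f t - P t\<bar> < e)"
proof -
  define F where "F z = f (Arg z)" for z
  have "isCont F z" if "z \<noteq> 0" for z
  proof (cases "z \<in> \<real>\<^sub>\<le>\<^sub>0")
    case False
    then show ?thesis
      unfolding F_def using assms(1) by (intro isCont_o2[OF continuous_at_Arg]) (auto simp: continuous_on_eq_continuous_at)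
  next
    \<comment> \<open>On the cut of \<open>Arg\<close> continuity comes from \<open>Arg2pi\<close>,
      which is continuous there and gives the same values of \<open>f\<close>.\<close>
    case True
    with that have "z \<notin> \<real>\<^sub>\<ge>\<^sub>0"
      by (auto simp: complex_nonpos_Reals_iff complex_nonneg_Reals_iff complex_eq_iff)
    then have "isCont (\<lambda>z. f (Arg2pi z)) z"
      using assms(1) by (intro isCont_o2[OF continuous_at_Arg2pi]) (auto simp: continuous_on_eq_continuous_at)
    moreover have "\<forall>\<^sub>F w in nhds z. w \<noteq> 0"
      using that by (rule t1_space_nhds)
    then have "\<forall>\<^sub>F w in nhds z. f (Arg2pi w) = F w"
      by eventually_elim (simp add: F_def periodic_Arg2pi assms(2))
    ultimately show ?thesis
      by (simp add: isCont_cong)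
  qed
  then have "continuous_on (sphere 0 1) F"
    by (intro continuous_at_imp_continuous_on) (metis dist_0_norm mem_sphere norm_zero zero_neq_one)
  then obtain g where g: "real_polynomial_function g" "\<And>z. z \<in> sphere 0 1 \<Longrightarrow> \<bar>F z - g z\<bar> < e"
    using Stone_Weierstrass_real_polynomial_function[OF compact_sphere _ assms(3)] by metis
  have "F (cis t) = f t" for t
  proof -
    have "cis (Arg (cis t)) = cis t"
      by (simp add: cis_Arg)
    then obtain k :: int where "Arg (cis t) = t + 2 * pi * of_int k"
      unfolding cis_conv_exp exp_eq by (auto simp: complex_eq_iff algebra_simps)
    then show ?thesis
      using assms(2) by (simp add: F_def periodic_plus_int)
  qed
  with g(2)[of "cis _"] trig_poly_real_polynomial[OF g(1)] show ?thesis
    by (intro exI[of _ "\<lambda>t. g (cis t)"]) auto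
qed

text \<open>Any \<open>N\<close> not below the frequencies of \<open>P\<close> will do. It depends
  on \<open>P\<close> only, so \<open>r\<close> may be the remainder of the partial sum of order
  \<open>N\<close> itself.\<close>

lemma trig_poly_orthogonal:
  assumes "trig_poly P"
  shows "\<exists>N. \<forall>r. L2 r \<longrightarrow> (\<forall>j\<in>{- int N..int N}. coef r j = 0) \<longrightarrow> (LINT t|circ. r t * P t) = 0"
  using assms
proof induction
  case (hart c j)
  show ?case
    by (intro exI[of _ "nat \<bar>j\<bar>"]) (auto simp: coef_def mult.left_commute dest!: bspec[where x = j])
next
  case (add f g)
  then obtain N1 N2 where N:
    "\<And>r. L2 r \<Longrightarrow> (\<forall>j\<in>{- int N1..int N1}. coef r j = 0) \<Longrightarrow> (LINT t|circ. r t * f t) = 0"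
    "\<And>r. L2 r \<Longrightarrow> (\<forall>j\<in>{- int N2..int N2}. coef r j = 0) \<Longrightarrow> (LINT t|circ. r t * g t) = 0"
    by metis
  show ?case
  proof (intro exI[of _ "max N1 N2"] allI impI)
    fix r assume r: "L2 r" "\<forall>j\<in>{- int (max N1 N2)..int (max N1 N2)}. coef r j = 0"
    then have "(LINT t|circ. r t * f t) = 0" "(LINT t|circ. r t * g t) = 0"
      by (auto intro!: N r(2)[rule_format])
    then show "(LINT t|circ. r t * (f t + g t)) = 0"
      using add(1,2) r(1) by (simp add: distrib_left integrable_L2_mult L2_trig_poly)
  qed
qed

text \<open>The half of Parseval's identity that complements Bessel: the remainder of a suitable
  partial sum has arbitrarily small square integral. An inequality between coefficients thereby
  becomes one between integrals.\<close>

lemma integral_square_le_coef_bound: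
  assumes "continuous_on UNIV f" "periodic f"
    and B: "\<And>N. (\<Sum>j\<in>{- int N..int N}. (coef f j)\<^sup>2) / (2 * pi) \<le> B"
  shows "(LINT t|circ. (f t)\<^sup>2) \<le> B"
proof (rule field_le_epsilon)
  fix e :: real assume "0 < e"
  \<comment> \<open>A uniform error \<open>d\<close> has square integral at most
    \<open>2 * pi * d\<^sup>2 = e\<close>.\<close>
  define d where "d = sqrt (e / (2 * pi))"
  have d: "0 < d" "2 * pi * d\<^sup>2 = e"
    using \<open>0 < e\<close> by (simp_all add: d_def)
  obtain P where P: "trig_poly P" "\<And>t. \<bar>f t - P t\<bar> < d"
    using trig_poly_dense[OF assms(1,2) d(1)] by blast
  obtain N where N: "\<And>r. L2 r \<Longrightarrow> \<forall>j\<in>{- int N..int N}. coef r j = 0 \<Longrightarrow> (LINT t|circ. r t * P t) = 0"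
    using trig_poly_orthogonal[OF P(1)] by metis
  let ?S = "partial_sum f N"
  define r where "r t = f t - ?S t" for t
  have f: "L2 f" by (intro L2_continuous assms)
  have r: "L2 r" unfolding r_def by (intro L2_diff f L2_partial_sum)
  have r0: "coef r j = 0" if "j \<in> {- int N..int N}" for j
    using that by (simp add: r_def[abs_def] coef_diff f L2_partial_sum coef_partial_sum)
  have PL: "L2 (\<lambda>t. f t - P t)"
    by (intro L2_diff f L2_trig_poly P)
  \<comment> \<open>The second factor \<open>r\<close> is split as \<open>(f - P) + P - ?S\<close>.
    Since \<open>r\<close> is orthogonal to \<open>P\<close> and \<open>?S\<close>, only
    \<open>f - P\<close> remains, and half of the square of \<open>r\<close> is then absorbed on the
    left.\<close>
  have "(LINT t|circ. r t * r t) = (LINT t|circ. r t * (f t - P t) + r t * P t - r t * ?S t)"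
    by (simp add: r_def algebra_simps)
  also have "\<dots> = (LINT t|circ. r t * (f t - P t)) + (LINT t|circ. r t * P t) - (LINT t|circ. r t * ?S t)"
    by (simp add: integrable_L2_mult r PL L2_trig_poly P L2_partial_sum)
  also have "\<dots> = (LINT t|circ. r t * (f t - P t))"
    using N[OF r] r0 by (simp add: integral_mult_partial_sum r)
  also have "\<dots> \<le> (LINT t|circ. 1/2 * (r t)\<^sup>2 + d\<^sup>2 / 2)"
  proof (rule integral_mono)
    show "r t * (f t - P t) \<le> 1/2 * (r t)\<^sup>2 + d\<^sup>2 / 2" for t
    proof -
      have "2 * r t * (f t - P t) \<le> (r t)\<^sup>2 + (f t - P t)\<^sup>2"
        by (rule sum_squares_bound)
      moreover have "(f t - P t)\<^sup>2 \<le> d\<^sup>2"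
        using P(2)[of t] d(1) by (simp add: abs_le_square_iff[symmetric])
      ultimately show ?thesis by simp
    qed
  qed (use r PL L2_const in \<open>auto simp: L2_def intro: integrable_L2_mult L2_imp_integrable\<close>)
  also have "\<dots> = 1/2 * (LINT t|circ. (r t)\<^sup>2) + e / 2"
    using r L2_imp_integrable[OF L2_const] d(2) by (simp add: L2_def)
  finally have "(LINT t|circ. (r t)\<^sup>2) \<le> e"
    by (simp add: power2_eq_square)
  then show "(LINT t|circ. (f t)\<^sup>2) \<le> B + e"
    unfolding integral_square_partial_sum[OF f, of N] using B[of N] by (simp add: r_def)
qed

section \<open>Wirtinger and shift inequalities for real functions\<close>

lemma abs_sin_mult_le: "\<bar>sin (real n * x)\<bar> \<le> real n * \<bar>sin x\<bar>"
proof (induction n)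
  case (Suc n)
  have "\<bar>sin (real (Suc n) * x)\<bar> = \<bar>sin (real n * x) * cos x + cos (real n * x) * sin x\<bar>"
    by (simp add: sin_add distrib_right) (simp add: algebra_simps)
  also have "\<dots> \<le> \<bar>sin (real n * x)\<bar> * 1 + 1 * \<bar>sin x\<bar>"
    unfolding abs_mult[symmetric]
    by (rule order_trans[OF abs_triangle_ineq], unfold abs_mult, intro add_mono mult_mono) auto
  finally show ?case using Suc by (simp add: algebra_simps)
qed simp

lemma sin_mult_square_le:
  fixes x :: real
  shows "(sin (of_int j * x))\<^sup>2 \<le> (of_int j)\<^sup>2 * (sin x)\<^sup>2"
proof -
  have "\<bar>sin (of_int j * x)\<bar> = \<bar>sin (real (nat \<bar>j\<bar>) * x)\<bar>"
    by (cases "0 \<le> j") auto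
  also have "\<dots> \<le> \<bar>of_int j * sin x\<bar>"
    using abs_sin_mult_le[of "nat \<bar>j\<bar>" x] by (simp add: abs_mult)
  finally show ?thesis
    by (simp add: abs_le_square_iff power_mult_distrib)
qed

text \<open>A shift mixes the coefficients \<open>j\<close> and \<open>- j\<close>, so sums over symmetric ranges can only be compared
  after symmetrization.\<close>

lemma sum_symmetric_le:
  fixes f g :: "int \<Rightarrow> real"
  assumes "\<And>j. f j + f (- j) \<le> g j + g (- j)"
  shows "(\<Sum>j\<in>{- int N..int N}. f j) \<le> (\<Sum>j\<in>{- int N..int N}. g j)"
proof -
  have s: "(\<Sum>j\<in>{- int N..int N}. h (- j)) = (\<Sum>j\<in>{- int N..int N}. h j)" for h :: "int \<Rightarrow> real"
    by (rule sum.reindex_bij_witness[of _ uminus uminus]) auto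
  have "(\<Sum>j\<in>{- int N..int N}. f j + f (- j)) \<le> (\<Sum>j\<in>{- int N..int N}. g j + g (- j))"
    by (intro sum_mono assms)
  then show ?thesis
    by (simp add: sum.distrib s)
qed

text \<open>Invariance of the integral moves the shift from \<open>f\<close> to the Hartley
  function, and \<open>hart_diff_arg\<close> splits the latter.\<close>

lemma coef_shift:
  assumes "continuous_on UNIV f" "periodic f"
  shows "coef (\<lambda>t. f (t + h)) j = cos (of_int j * h) * coef f j - sin (of_int j * h) * coef f (- j)"
proof -
  have f: "L2 f" by (intro L2_continuous assms)
  define F where "F s = f s * hart j (s - h)" for s
  have "continuous_on UNIV F"
    unfolding F_def by (intro continuous_intros assms continuous_on_compose2[OF continuous_on_hart[of UNIV]]) auto
  moreover have "periodic F"
    using assms(2) periodic_hart[of j] unfolding periodic_def F_def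
    by (metis add_diff_eq diff_add_eq)
  ultimately have "(LINT t|circ. F (t + h)) = integral\<^sup>L circ F"
    by (rule integral_circ_shift)
  moreover have "F (t + h) = f (t + h) * hart j t" for t
    by (simp add: F_def)
  ultimately have "coef (\<lambda>t. f (t + h)) j = (LINT t|circ. F t)"
    by (simp add: coef_def)
  also have "\<dots> = (LINT t|circ. cos (of_int j * h) * (f t * hart j t) - sin (of_int j * h) * (f t * hart (- j) t))"
    unfolding F_def hart_diff_arg by (simp add: algebra_simps)
  also have "\<dots> = cos (of_int j * h) * coef f j - sin (of_int j * h) * coef f (- j)"
    unfolding coef_def using f by (simp add: integrable_L2_mult L2_hart)
  finally show ?thesis .
qed

text \<open>The derivative enters only through its coefficients. The factor \<open>j\<^sup>2\<close>
  is at least \<open>1\<close> except at \<open>j = 0\<close>, where the zero mean removes the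
  coefficient.\<close>

lemma Wirtinger_scalar:
  assumes "continuous_on UNIV f" "periodic f" "integral\<^sup>L circ f = 0" "L2 g"
    and coef: "\<And>j. coef g j = - of_int j * coef f (- j)"
  shows "(LINT t|circ. (f t)\<^sup>2) \<le> (LINT t|circ. (g t)\<^sup>2)"
proof (rule integral_square_le_coef_bound[OF assms(1,2)])
  fix N
  have 0: "coef f 0 = 0"
    using assms(3) by (simp add: coef_def hart_def)
  have "(coef f j)\<^sup>2 \<le> (coef g (- j))\<^sup>2" for j
  proof (cases "j = 0")
    case False
    then have "1 \<le> j\<^sup>2"
      by (simp add: int_one_le_iff_zero_less)
    then have "1 * (coef f j)\<^sup>2 \<le> of_int (j\<^sup>2) * (coef f j)\<^sup>2"
      by (intro mult_right_mono) (simp_all only: of_int_1_le_iff zero_le_power2)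
    then show ?thesis by (simp add: coef power_mult_distrib)
  qed (simp add: 0)
  \<comment> \<open>The coefficient of \<open>f\<close> at \<open>j\<close> is compared with that of
    \<open>g\<close> at \<open>- j\<close>, which is harmless after symmetrization.\<close>
  from this[of "- _"] this have "(\<Sum>j\<in>{- int N..int N}. (coef f j)\<^sup>2) \<le> (\<Sum>j\<in>{- int N..int N}. (coef g j)\<^sup>2)"
    by (intro sum_symmetric_le) (metis add.commute add_mono minus_minus)
  then show "(\<Sum>j\<in>{- int N..int N}. (coef f j)\<^sup>2) / (2 * pi) \<le> (LINT t|circ. (g t)\<^sup>2)"
    using Bessel_inequality[OF assms(4), of N] by (simp add: field_simps)
qed

text \<open>The difference multiplies the energy at the frequencies \<open>j\<close> and
  \<open>- j\<close> by \<open>2 - 2 * cos (j h) = 4 (sin (j h / 2))\<^sup>2\<close>. The bound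
  \<open>j\<^sup>2 (sin (h / 2))\<^sup>2\<close> for the squared sine leaves the energy of the
  derivative, since \<open>j\<^sup>2\<close> is its multiplier.\<close>

lemma shift_inequality_scalar:
  assumes "continuous_on UNIV f" "periodic f" "L2 g"
    and coef: "\<And>j. coef g j = - of_int j * coef f (- j)"
  shows "(LINT t|circ. (f (t + h) - f t)\<^sup>2) \<le> 4 * (sin (h / 2))\<^sup>2 * (LINT t|circ. (g t)\<^sup>2)"
proof (rule integral_square_le_coef_bound)
  have c: "continuous_on UNIV (\<lambda>t. f (t + h))"
    by (intro continuous_on_compose2[OF assms(1)] continuous_intros) auto
  with assms(1) show "continuous_on UNIV (\<lambda>t. f (t + h) - f t)"
    by (intro continuous_intros)
  show "periodic (\<lambda>t. f (t + h) - f t)"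
    using assms(2) unfolding periodic_def by (metis add.assoc add.commute)
  fix N
  let ?w = "\<lambda>t. f (t + h) - f t"
  let ?g = "\<lambda>j. 4 * (sin (h / 2))\<^sup>2 * (coef g j)\<^sup>2"
  have w: "coef ?w j = (cos (of_int j * h) - 1) * coef f j - sin (of_int j * h) * coef f (- j)" for j
    by (simp add: coef_diff coef_shift L2_continuous assms c algebra_simps)
  have "(\<Sum>j\<in>{- int N..int N}. (coef ?w j)\<^sup>2) \<le> (\<Sum>j\<in>{- int N..int N}. ?g j)"
  proof (rule sum_symmetric_le)
    fix j
    \<comment> \<open>This is multiplication of \<open>x + i y\<close> by
      \<open>C - 1 + i S\<close>, a number of square modulus \<open>2 - 2 * C\<close>.\<close>
    have alg: "((C - 1) * x - S * y)\<^sup>2 + ((C - 1) * y + S * x)\<^sup>2 = (2 - 2 * C) * (x\<^sup>2 + y\<^sup>2)"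
      if "C\<^sup>2 + S\<^sup>2 = 1" for C S x y :: real
      using that by algebra
    have "cos (of_int j * h) = 1 - 2 * (sin (of_int j * (h / 2)))\<^sup>2"
      using cos_double_sin[of "of_int j * (h / 2)"] by simp
    then have "2 - 2 * cos (of_int j * h) \<le> 4 * ((of_int j)\<^sup>2 * (sin (h / 2))\<^sup>2)"
      using sin_mult_square_le[of j "h / 2"] by simp
    then have "(2 - 2 * cos (of_int j * h)) * ((coef f j)\<^sup>2 + (coef f (- j))\<^sup>2)
        \<le> 4 * ((of_int j)\<^sup>2 * (sin (h / 2))\<^sup>2) * ((coef f j)\<^sup>2 + (coef f (- j))\<^sup>2)"
      by (intro mult_right_mono) auto
    also have "\<dots> = ?g j + ?g (- j)"
      by (simp add: coef power_mult_distrib algebra_simps)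
    finally show "(coef ?w j)\<^sup>2 + (coef ?w (- j))\<^sup>2 \<le> ?g j + ?g (- j)"
      using alg[of "cos (of_int j * h)" "sin (of_int j * h)" "coef f j" "coef f (- j)"]
      by (simp add: w)
  qed
  also have "\<dots> = 4 * (sin (h / 2))\<^sup>2 * (\<Sum>j\<in>{- int N..int N}. (coef g j)\<^sup>2)"
    by (simp add: sum_distrib_left)
  finally have "(\<Sum>j\<in>{- int N..int N}. (coef ?w j)\<^sup>2)
      \<le> 4 * (sin (h / 2))\<^sup>2 * (\<Sum>j\<in>{- int N..int N}. (coef g j)\<^sup>2)" .
  from divide_right_mono[OF this, of "2 * pi"]
  have "(\<Sum>j\<in>{- int N..int N}. (coef ?w j)\<^sup>2) / (2 * pi)
      \<le> 4 * (sin (h / 2))\<^sup>2 * ((\<Sum>j\<in>{- int N..int N}. (coef g j)\<^sup>2) / (2 * pi))"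
    by simp
  also have "\<dots> \<le> 4 * (sin (h / 2))\<^sup>2 * (LINT t|circ. (g t)\<^sup>2)"
    using Bessel_inequality[OF assms(3), of N] by (intro mult_left_mono) auto
  finally show "(\<Sum>j\<in>{- int N..int N}. (coef ?w j)\<^sup>2) / (2 * pi)
      \<le> 4 * (sin (h / 2))\<^sup>2 * (LINT t|circ. (g t)\<^sup>2)" .
qed

section \<open>Uniqueness of Fourier coefficients\<close>

lemma L2_orthogonal_continuous:
  assumes d: "L2 d" "\<And>j. coef d j = 0" and f: "continuous_on UNIV f" "periodic f"
  shows "(LINT t|circ. d t * f t) = 0"
proof -
  define D where "D = (LINT t|circ. \<bar>d t\<bar>)"
  have dint: "integrable circ d" by (rule L2_imp_integrable[OF d(1)])
  have "\<bar>LINT t|circ. d t * f t\<bar> \<le> 0 + e" if "e > 0" for e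
  proof -
    \<comment> \<open>The summand \<open>1\<close> avoids division by zero when
      \<open>D = 0\<close>.\<close>
    define e' where "e' = e / (D + 1)"
    have D: "0 \<le> D" unfolding D_def by (rule integral_nonneg_AE) simp
    have e': "e' > 0" "e' * D \<le> e"
      using that D by (auto simp: e'_def field_simps)
    obtain P where P: "trig_poly P" "\<And>t. \<bar>f t - P t\<bar> < e'"
      using trig_poly_dense[OF f e'(1)] by blast
    have fP: "L2 (\<lambda>t. f t - P t)"
      by (intro L2_diff L2_continuous f L2_trig_poly P)
    have "(LINT t|circ. d t * P t) = 0"
      using trig_poly_orthogonal[OF P(1)] d by blast
    moreover have "(LINT t|circ. d t * f t) = (LINT t|circ. d t * (f t - P t) + d t * P t)"
      by (simp add: algebra_simps)
    ultimately have "\<bar>LINT t|circ. d t * f t\<bar> = \<bar>LINT t|circ. d t * (f t - P t)\<bar>"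
      using d(1) fP L2_trig_poly[OF P(1)] by (simp add: integrable_L2_mult)
    also have "\<dots> \<le> (LINT t|circ. \<bar>d t * (f t - P t)\<bar>)"
      by (rule integral_abs_bound)
    also have "\<dots> \<le> (LINT t|circ. e' * \<bar>d t\<bar>)"
    proof (rule integral_mono)
      show "\<bar>d t * (f t - P t)\<bar> \<le> e' * \<bar>d t\<bar>" for t
        using P(2)[of t] mult_right_mono[of "\<bar>f t - P t\<bar>" e' "\<bar>d t\<bar>"] by (simp add: abs_mult mult.commute)
    qed (use dint integrable_L2_mult[OF d(1) fP] in auto)
    finally show ?thesis using e' by (simp add: D_def)
  qed
  then have "\<bar>LINT t|circ. d t * f t\<bar> \<le> 0"
    by (rule field_le_epsilon)
  then show ?thesis by simp
qed

text \<open>Describes an interval by a periodic continuous function: \<open>t\<close> lies in it iff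
  its distance \<open>x\<close> to the midpoint is below the half-length \<open>w\<close>, and
  \<open>cos\<close> decreases on distances up to \<open>pi\<close>. A larger \<open>x\<close> is
  reflected to \<open>2 * pi - x\<close>, which is still at least \<open>w\<close>.\<close>

lemma cos_less_cos_iff_near:
  assumes "0 \<le> a" "a < b" "b \<le> 2 * pi" "t \<in> {0..2 * pi}"
  shows "cos ((b - a) / 2) < cos (t - (a + b) / 2) \<longleftrightarrow> t \<in> {a<..<b}"
proof -
  define w where "w = (b - a) / 2"
  define x where "x = \<bar>t - (a + b) / 2\<bar>"
  have w: "0 < w" "w \<le> pi" using assms by (auto simp: w_def)
  have x: "0 \<le> x" "x \<le> 2 * pi - w" using assms by (auto simp: x_def w_def abs_if field_simps)
  have "cos (t - (a + b) / 2) = cos x" by (simp add: x_def)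
  moreover have "t \<in> {a<..<b} \<longleftrightarrow> x < w" by (auto simp: x_def w_def abs_if field_simps)
  moreover have "cos w < cos x \<longleftrightarrow> x < w"
  proof (cases "x \<le> pi")
    case True
    then show ?thesis using w x cos_mono_less_eq[of w x] by simp
  next
    case False
    have "cos x = cos (2 * pi - x)" by simp
    also have "\<dots> \<le> cos w"
      using False w x by (intro cos_monotone_0_pi_le) auto
    finally show ?thesis using False w by auto
  qed
  ultimately show ?thesis by (simp add: w_def)
qed

lemma L2_coef_zero_interval:
  assumes d: "L2 d" "\<And>j. coef d j = 0" and ab: "0 \<le> a" "a < b" "b \<le> 2 * pi"
  shows "(LINT t|circ. d t * indicator {a<..<b} t) = 0"
proof -
  \<comment> \<open>continuous periodic functions that converge to the indicator of the arc\<close>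
  define f where "f n t = min 1 (real n * max 0 (cos (t - (a + b) / 2) - cos ((b - a) / 2)))" for n t
  have dm: "d \<in> borel_measurable circ" using d(1) by (simp add: L2_def)
  have c: "continuous_on UNIV (f n)" for n
    unfolding f_def by (intro continuous_intros)
  have "periodic (f n)" for n
    unfolding periodic_def f_def by (metis add_diff_eq cos_periodic add.commute diff_add_eq)
  then have 0: "(LINT t|circ. d t * f n t) = 0" for n
    by (intro L2_orthogonal_continuous d c)
  have "(\<lambda>n. LINT t|circ. d t * f n t) \<longlonglongrightarrow> (LINT t|circ. d t * indicator {a<..<b} t)"
  proof (rule integral_dominated_convergence)
    show "(\<lambda>t. d t * indicator {a<..<b} t) \<in> borel_measurable circ"
      by (rule borel_measurable_times[OF dm measurable_circ]) auto
    show "(\<lambda>t. d t * f n t) \<in> borel_measurable circ" for n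
      by (rule borel_measurable_times[OF dm measurable_circ]) (intro borel_measurable_continuous_onI c)
    show "integrable circ (\<lambda>t. \<bar>d t\<bar>)"
      using L2_imp_integrable[OF d(1)] by simp
    show "AE t in circ. norm (d t * f n t) \<le> \<bar>d t\<bar>" for n
    proof (rule AE_I2)
      fix t
      have "\<bar>f n t\<bar> \<le> 1" by (auto simp: f_def)
      then show "norm (d t * f n t) \<le> \<bar>d t\<bar>"
        using mult_left_mono[of "\<bar>f n t\<bar>" 1 "\<bar>d t\<bar>"] by (simp add: abs_mult)
    qed
    show "AE t in circ. (\<lambda>n. d t * f n t) \<longlonglongrightarrow> d t * indicator {a<..<b} t"
    proof (rule AE_I2)
      fix t assume "t \<in> space circ"
      then have t: "t \<in> {0..2 * pi}" by (simp add: space_restrict_space)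
      have "(\<lambda>n. f n t) \<longlonglongrightarrow> indicator {a<..<b} t"
      proof (cases "t \<in> {a<..<b}")
        case True
        define y where "y = cos (t - (a + b) / 2) - cos ((b - a) / 2)"
        have y: "y > 0" using True cos_less_cos_iff_near[OF ab t] by (simp add: y_def)
        obtain N :: nat where N: "1 / y < real N" using reals_Archimedean2 by blast
        have "f n t = 1" if "n \<ge> N" for n
        proof -
          have "1 / y \<le> real n" using N that by (simp add: order_trans less_imp_le)
          then have "1 \<le> real n * y" using y by (simp add: field_simps)
          then show ?thesis using y by (simp add: f_def y_def[symmetric])
        qed
        then have "\<forall>\<^sub>F n in sequentially. f n t = 1" by (auto simp: eventually_sequentially)
        then show ?thesis using True by (simp add: tendsto_eventually)
      next
        case False
        then have "cos (t - (a + b) / 2) \<le> cos ((b - a) / 2)"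
          using cos_less_cos_iff_near[OF ab t] by linarith
        then have "f n t = 0" for n
          by (simp add: f_def max_absorb1)
        then show ?thesis using False by simp
      qed
      then show "(\<lambda>n. d t * f n t) \<longlonglongrightarrow> d t * indicator {a<..<b} t"
        by (intro tendsto_intros)
    qed
  qed
  then show ?thesis using 0 by (simp add: LIMSEQ_const_iff)
qed

text \<open>The extension \<open>g\<close> of \<open>d\<close> by zero has integral zero over all
  half-lines. These are an intersection-stable generator of the Borel sets, so the integral over
  every Borel set vanishes and \<open>g\<close> is zero almost everywhere.\<close>

lemma L2_coef_zero:
  assumes d: "L2 d" "\<And>j. coef d j = 0"
  shows "AE t in circ. d t = 0"
proof -
  define g where "g t = indicator {0..2 * pi} t * d t" for t
  have g: "integrable lborel g"
    using L2_imp_integrable[OF d(1)] by (simp add: integrable_restrict_space g_def[abs_def])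
  have g_meas [measurable]: "g \<in> borel_measurable borel"
    using borel_measurable_integrable[OF g] by simp
  have base: "(LINT t:{..a}|lborel. g t) = 0" for a
  proof (cases "a < 0")
    case True
    then have "(\<lambda>t. indicator {..a} t *\<^sub>R g t) = (\<lambda>_. 0)"
      by (auto simp: g_def indicator_def)
    then show ?thesis by (simp add: set_lebesgue_integral_def)
  next
    case False
    \<comment> \<open>Beyond \<open>2 * pi\<close> the function \<open>g\<close> vanishes, so the
      interval is cut there; its endpoints are null sets.\<close>
    define b where "b = min a (2 * pi)"
    have "(LINT t|lborel. indicator {..a} t *\<^sub>R g t) = (LINT t|lborel. indicator {0..2 * pi} t *\<^sub>R (d t * indicator {0<..<b} t))"
    proof (rule integral_cong_AE)
      have "AE t in lborel. t \<noteq> 0 \<and> t \<noteq> b"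
        using AE_lborel_singleton[of 0] AE_lborel_singleton[of b] by eventually_elim simp
      then show "AE t in lborel. indicator {..a} t *\<^sub>R g t = indicator {0..2 * pi} t *\<^sub>R (d t * indicator {0<..<b} t)"
        by eventually_elim (auto simp: g_def b_def indicator_def)
      have "(\<lambda>t. indicator {0..2 * pi} t *\<^sub>R (d t * indicator {0<..<b} t)) = (\<lambda>t. g t * indicator {0<..<b} t)"
        by (auto simp: g_def)
      then show "(\<lambda>t. indicator {0..2 * pi} t *\<^sub>R (d t * indicator {0<..<b} t)) \<in> borel_measurable lborel"
        by simp
    qed simp
    also have "\<dots> = (LINT t|circ. d t * indicator {0<..<b} t)"
      by (simp add: integral_restrict_space)
    also have "\<dots> = 0"
    proof (cases "b = 0")
      case False
      then show ?thesis using \<open>\<not> a < 0\<close> by (intro L2_coef_zero_interval d) (auto simp: b_def min_def split: if_splits)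
    qed simp
    finally show ?thesis by (simp add: set_lebesgue_integral_def)
  qed
  have univ: "(LINT t|lborel. g t) = 0"
  proof -
    have "(\<lambda>t. indicator {..2 * pi} t *\<^sub>R g t) = g" by (auto simp: g_def indicator_def)
    then show ?thesis using base[of "2 * pi"] by (simp add: set_lebesgue_integral_def)
  qed
  have "(LINT t:A|lborel. g t) = 0" if "A \<in> sets lborel" for A
  proof -
    have "Int_stable (range (\<lambda>a::real. {..a}))"
      by (auto simp: Int_stable_def)
    moreover have "range (\<lambda>a::real. {..a}) \<subseteq> Pow UNIV"
      by simp
    moreover have "A \<in> sigma_sets UNIV (range (\<lambda>a::real. {..a}))"
      using that by (simp add: borel_eq_atMost)
    ultimately show ?thesis
    proof (induction rule: sigma_sets_induct_disjoint)
      case (compl A)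
      then have A: "A \<in> sets lborel" by (simp add: borel_eq_atMost)
      have "(LINT t:UNIV - A|lborel. g t) = (LINT t|lborel. g t - indicator A t *\<^sub>R g t)"
        unfolding set_lebesgue_integral_def by (rule Bochner_Integration.integral_cong) (auto simp: indicator_def)
      also have "\<dots> = 0"
        using g compl A univ integrable_mult_indicator[OF A g]
        by (simp add: set_lebesgue_integral_def)
      finally show ?case .
    next
      case (union A)
      have "A i \<in> sets lborel" for i
        using union(2) by (auto simp: borel_eq_atMost)
      then have "(LINT t:(\<Union>i. A i)|lborel. g t) = (\<Sum>i. LINT t:A i|lborel. g t)"
        using union(1) g integrable_mult_indicator[of "\<Union>i. A i" lborel g]
        by (intro lebesgue_integral_countable_add)
          (auto simp: disjoint_family_on_def set_integrable_def)
      then show ?case using union(3) by simp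
    qed (use base in \<open>auto simp: set_lebesgue_integral_def\<close>)
  qed
  then have "AE t in lborel. g t = 0"
    by (rule sigma_finite_measure.density_zero[OF sigma_finite_lborel g])
  then show ?thesis
    by (subst AE_restrict_space_iff) (auto elim!: eventually_mono simp: g_def)
qed

section \<open>Weak derivatives\<close>

text \<open>With Hartley functions as test functions, the coefficients of a weak derivative can be
  read off. Every iterated derivative is a multiple of some \<open>hart i\<close>, which carries the
  induction.\<close>

lemma test_function_hart: "test_function (hart j)"
proof -
  have d: "((\<lambda>t. c * hart i t) has_real_derivative c * of_int i * hart (- i) t) (at t)" for c i t
    using DERIV_cmult[OF hart_has_derivative[of i t], of c] by (simp add: mult.assoc)
  have "\<exists>c i. (deriv ^^ k) (hart j) = (\<lambda>t. c * hart i t)" for k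
  proof (induction k)
    case 0
    show ?case by (intro exI[of _ 1] exI[of _ j]) auto
  next
    case (Suc k)
    then obtain c i where "(deriv ^^ k) (hart j) = (\<lambda>t. c * hart i t)" by blast
    moreover have "deriv (\<lambda>t. c * hart i t) = (\<lambda>t. c * of_int i * hart (- i) t)"
      using d[THEN DERIV_imp_deriv] by (simp add: fun_eq_iff)
    ultimately have "(deriv ^^ Suc k) (hart j) = (\<lambda>t. c * of_int i * hart (- i) t)"
      by simp
    then show ?case by blast
  qed
  moreover have "(\<lambda>t. c * hart i t) differentiable_on UNIV" for c i
    using d[of c i] by (auto simp: differentiable_on_def real_differentiable_def)
  ultimately show ?thesis
    unfolding test_function_def using periodic_hart by metis
qed

lemma deriv_hart: "deriv (hart j) = (\<lambda>t. of_int j * hart (- j) t)"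
  using hart_has_derivative[THEN DERIV_imp_deriv] by blast

lemma square_integrable_iff_circ:
  "square_integrable v \<longleftrightarrow> v \<in> borel_measurable borel \<and> integrable circ (\<lambda>t. (norm (v t))\<^sup>2)"
  by (simp add: square_integrable_def set_integrable_circ)

lemma L2_component:
  assumes "square_integrable v"
  shows "L2 (\<lambda>t. v t \<bullet> b)"
proof -
  have v: "v \<in> borel_measurable borel" "integrable circ (\<lambda>t. (norm (v t))\<^sup>2)"
    using assms by (auto simp: square_integrable_iff_circ)
  have m: "(\<lambda>t. v t \<bullet> b) \<in> borel_measurable circ"
    using v(1) by (intro measurable_circ) simp
  show ?thesis
    unfolding L2_def
  proof (intro conjI m)
    show "integrable circ (\<lambda>t. (v t \<bullet> b)\<^sup>2)"
    proof (rule Bochner_Integration.integrable_bound)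
      show "integrable circ (\<lambda>t. (norm b)\<^sup>2 * (norm (v t))\<^sup>2)"
        using v(2) by simp
      have "(v t \<bullet> b)\<^sup>2 \<le> (norm b)\<^sup>2 * (norm (v t))\<^sup>2" for t
        using Cauchy_Schwarz_ineq[of "v t" b] by (simp add: power2_norm_eq_inner mult.commute)
      then show "AE t in circ. norm ((v t \<bullet> b)\<^sup>2) \<le> norm ((norm b)\<^sup>2 * (norm (v t))\<^sup>2)"
        by simp
    qed (use m in simp)
  qed
qed

lemma integrable_hart_scaleR:
  assumes "square_integrable v"
  shows "integrable circ (\<lambda>t. hart j t *\<^sub>R v t)"
proof -
  have v: "v \<in> borel_measurable borel" "integrable circ (\<lambda>t. (norm (v t))\<^sup>2)"
    using assms by (auto simp: square_integrable_iff_circ)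
  have h: "hart j \<in> borel_measurable borel"
    by (intro borel_measurable_continuous_onI continuous_intros)
  have "L2 (\<lambda>t. norm (v t))"
    using v by (auto simp: L2_def intro!: measurable_circ)
  from integrable_L2_mult[OF L2_hart[of j] this] show ?thesis
  proof (rule Bochner_Integration.integrable_bound)
    show "(\<lambda>t. hart j t *\<^sub>R v t) \<in> borel_measurable circ"
      using h v(1) by (intro measurable_circ borel_measurable_scaleR)
  qed simp
qed

text \<open>Testing against \<open>hart j\<close>, whose derivative is
  \<open>j * hart (- j)\<close>; the inner product with \<open>b\<close> commutes with the
  integrals.\<close>

lemma coef_weak_derivative:
  assumes "has_weak_derivative u v" "continuous_on UNIV u" "square_integrable v"
  shows "coef (\<lambda>t. v t \<bullet> b) j = - of_int j * coef (\<lambda>t. u t \<bullet> b) (- j)"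
proof -
  have "(LINT t|circ. deriv (hart j) t *\<^sub>R u t) = - (LINT t|circ. hart j t *\<^sub>R v t)"
    using assms(1) test_function_hart by (auto simp: has_weak_derivative_def LINT_circ)
  then have "(LINT t|circ. of_int j *\<^sub>R (hart (- j) t *\<^sub>R u t)) = - (LINT t|circ. hart j t *\<^sub>R v t)"
    by (simp add: deriv_hart)
  then have eq: "(LINT t|circ. hart j t *\<^sub>R v t) = - (of_int j *\<^sub>R (LINT t|circ. hart (- j) t *\<^sub>R u t))"
    unfolding integral_scaleR_right by simp
  have u: "integrable circ (\<lambda>t. hart (- j) t *\<^sub>R u t)"
    by (intro integrable_circ_continuous continuous_intros assms)
  have "coef (\<lambda>t. v t \<bullet> b) j = (LINT t|circ. (hart j t *\<^sub>R v t) \<bullet> b)"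
    by (simp add: coef_def mult.commute)
  also have "\<dots> = (LINT t|circ. hart j t *\<^sub>R v t) \<bullet> b"
    by (rule integral_inner_left[OF integrable_hart_scaleR[OF assms(3)]])
  also have "\<dots> = - of_int j * ((LINT t|circ. hart (- j) t *\<^sub>R u t) \<bullet> b)"
    unfolding eq by simp
  also have "(LINT t|circ. hart (- j) t *\<^sub>R u t) \<bullet> b = (LINT t|circ. (hart (- j) t *\<^sub>R u t) \<bullet> b)"
    by (rule integral_inner_left[OF u, symmetric])
  also have "\<dots> = coef (\<lambda>t. u t \<bullet> b) (- j)"
    by (simp add: coef_def mult.commute)
  finally show ?thesis .
qed

lemma integral_norm_square_components:
  fixes f :: "real \<Rightarrow> 'a::euclidean_space"
  assumes "\<And>b. b \<in> Basis \<Longrightarrow> L2 (\<lambda>t. f t \<bullet> b)"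
  shows "(LINT t|circ. (norm (f t))\<^sup>2) = (\<Sum>b\<in>Basis. LINT t|circ. (f t \<bullet> b)\<^sup>2)"
proof -
  have "(norm (f t))\<^sup>2 = (\<Sum>b\<in>Basis. (f t \<bullet> b)\<^sup>2)" for t
  proof -
    have "(norm (f t))\<^sup>2 = f t \<bullet> f t" by (rule power2_norm_eq_inner)
    also have "\<dots> = (\<Sum>b\<in>Basis. (f t \<bullet> b) * (f t \<bullet> b))" by (rule euclidean_inner)
    finally show ?thesis by (simp only: power2_eq_square[symmetric])
  qed
  then have "(LINT t|circ. (norm (f t))\<^sup>2) = (LINT t|circ. (\<Sum>b\<in>Basis. (f t \<bullet> b)\<^sup>2))"
    by simp
  also have "\<dots> = (\<Sum>b\<in>Basis. LINT t|circ. (f t \<bullet> b)\<^sup>2)"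
    using assms by (intro Bochner_Integration.integral_sum) (auto simp: L2_def)
  finally show ?thesis .
qed

lemma Wirtinger_inequality:
  assumes "continuous_on UNIV u" "periodic u" "integral\<^sup>L circ u = 0"
    and "square_integrable v" "has_weak_derivative u v"
  shows "(LINT t|circ. (norm (u t))\<^sup>2) \<le> (LINT t|circ. (norm (v t))\<^sup>2)"
proof -
  have c: "continuous_on UNIV (\<lambda>t. u t \<bullet> b)" for b
    by (intro continuous_intros assms)
  have "(LINT t|circ. (u t \<bullet> b)\<^sup>2) \<le> (LINT t|circ. (v t \<bullet> b)\<^sup>2)" for b
  proof (rule Wirtinger_scalar[OF c])
    show "periodic (\<lambda>t. u t \<bullet> b)" using assms(2) by (simp add: periodic_def)
    show "(LINT t|circ. u t \<bullet> b) = 0"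
      using assms(3) integrable_circ_continuous[OF assms(1)] by simp
  qed (use assms coef_weak_derivative L2_component in blast)+
  moreover have "(LINT t|circ. (norm (u t))\<^sup>2) = (\<Sum>b\<in>Basis. LINT t|circ. (u t \<bullet> b)\<^sup>2)"
    by (intro integral_norm_square_components L2_continuous c)
  moreover have "(LINT t|circ. (norm (v t))\<^sup>2) = (\<Sum>b\<in>Basis. LINT t|circ. (v t \<bullet> b)\<^sup>2)"
    by (intro integral_norm_square_components L2_component assms)
  ultimately show ?thesis
    by (simp only: sum_mono)
qed

lemma shift_inequality:
  assumes "continuous_on UNIV u" "periodic u" "square_integrable v" "has_weak_derivative u v"
  shows "(LINT t|circ. (norm (u (t + h) - u t))\<^sup>2) \<le> 4 * (sin (h / 2))\<^sup>2 * (LINT t|circ. (norm (v t))\<^sup>2)"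
proof -
  have c: "continuous_on UNIV (\<lambda>t. u t \<bullet> b)" for b
    by (intro continuous_intros assms)
  have ch: "continuous_on UNIV (\<lambda>t. u (t + h))"
    by (intro continuous_on_compose2[OF assms(1)] continuous_intros) auto
  have "(LINT t|circ. ((u (t + h) - u t) \<bullet> b)\<^sup>2) \<le> 4 * (sin (h / 2))\<^sup>2 * (LINT t|circ. (v t \<bullet> b)\<^sup>2)" for b
    unfolding inner_diff_left
  proof (rule shift_inequality_scalar[OF c])
    show "periodic (\<lambda>t. u t \<bullet> b)" using assms(2) by (simp add: periodic_def)
  qed (use assms coef_weak_derivative L2_component in blast)+
  moreover have "(LINT t|circ. (norm (u (t + h) - u t))\<^sup>2) = (\<Sum>b\<in>Basis. LINT t|circ. ((u (t + h) - u t) \<bullet> b)\<^sup>2)"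
    by (intro integral_norm_square_components L2_continuous continuous_intros assms ch)
  moreover have "(LINT t|circ. (norm (v t))\<^sup>2) = (\<Sum>b\<in>Basis. LINT t|circ. (v t \<bullet> b)\<^sup>2)"
    by (intro integral_norm_square_components L2_component assms)
  ultimately show ?thesis
    by (simp only: sum_mono sum_distrib_left)
qed

text \<open>\<open>weak_deriv\<close> is an arbitrary choice. Two weak derivatives have equal
  coefficients and so agree almost everywhere, which makes the kinetic energy of an explicit loop
  computable.\<close>

lemma weak_derivative_norm_unique:
  assumes "continuous_on UNIV u"
    and v: "square_integrable v" "has_weak_derivative u v"
    and w: "square_integrable w" "has_weak_derivative u w"
  shows "(LINT t|circ. (norm (v t))\<^sup>2) = (LINT t|circ. (norm (w t))\<^sup>2)"
proof -
  have "(LINT t|circ. (v t \<bullet> b)\<^sup>2) = (LINT t|circ. (w t \<bullet> b)\<^sup>2)" for b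
  proof (rule integral_cong_AE)
    have L: "L2 (\<lambda>t. v t \<bullet> b)" "L2 (\<lambda>t. w t \<bullet> b)"
      using v w L2_component by auto
    then show "(\<lambda>t. (v t \<bullet> b)\<^sup>2) \<in> borel_measurable circ" "(\<lambda>t. (w t \<bullet> b)\<^sup>2) \<in> borel_measurable circ"
      by (auto simp: L2_def)
    have "AE t in circ. v t \<bullet> b - w t \<bullet> b = 0"
      using L assms by (intro L2_coef_zero L2_diff) (simp_all add: coef_diff coef_weak_derivative)
    then show "AE t in circ. (v t \<bullet> b)\<^sup>2 = (w t \<bullet> b)\<^sup>2"
      by eventually_elim simp
  qed
  then have "(\<Sum>b\<in>Basis. LINT t|circ. (v t \<bullet> b)\<^sup>2) = (\<Sum>b\<in>Basis. LINT t|circ. (w t \<bullet> b)\<^sup>2)"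
    by (simp only:)
  then show ?thesis
    by (subst (1 2) integral_norm_square_components) (auto intro: L2_component v w)
qed

text \<open>Integration by parts: the product of \<open>u\<close> with the test function is
  periodic, so its derivative has integral zero.\<close>

lemma has_weak_derivative_classical:
  assumes "\<And>t. (u has_vector_derivative v t) (at t)" "continuous_on UNIV v" "periodic u" "periodic v"
  shows "has_weak_derivative u v"
  unfolding has_weak_derivative_def
proof (intro conjI allI impI assms)
  fix \<phi> assume "test_function \<phi>"
  then have \<phi>: "periodic \<phi>" "\<phi> differentiable_on UNIV" "deriv \<phi> differentiable_on UNIV"
    unfolding test_function_def by (auto dest: spec[of _ 0] spec[of _ 1])
  have D: "(\<phi> has_vector_derivative deriv \<phi> t) (at t)" for t
    using \<phi>(2) by (metis DERIV_deriv_iff_real_differentiable UNIV_I at_within_open differentiable_on_def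
      has_real_derivative_iff_has_vector_derivative open_UNIV)
  have cu: "continuous_on UNIV u"
    using assms(1) by (meson continuous_at_imp_continuous_on has_vector_derivative_continuous)
  have c: "continuous_on UNIV (\<lambda>t. deriv \<phi> t *\<^sub>R u t)" "continuous_on UNIV (\<lambda>t. \<phi> t *\<^sub>R v t)"
    using \<phi>(2,3)[THEN differentiable_imp_continuous_on] cu assms(2) by (auto intro!: continuous_intros)
  have "(LINT t|circ. deriv \<phi> t *\<^sub>R u t + \<phi> t *\<^sub>R v t) = 0"
  proof (rule integral_circ_periodic_deriv)
    show "((\<lambda>t. \<phi> t *\<^sub>R u t) has_vector_derivative deriv \<phi> t *\<^sub>R u t + \<phi> t *\<^sub>R v t) (at t)" for t
      using has_vector_derivative_scaleR[of \<phi> "deriv \<phi> t" t UNIV u "v t"] D[of t] assms(1)[of t]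
      by (simp add: has_real_derivative_iff_has_vector_derivative add.commute)
    show "periodic (\<lambda>t. \<phi> t *\<^sub>R u t)"
      using \<phi>(1) assms(3) by (simp add: periodic_def)
  qed (intro continuous_intros c)
  then show "(LINT t:{0..2 * pi}|lborel. deriv \<phi> t *\<^sub>R u t) = - (LINT t:{0..2 * pi}|lborel. \<phi> t *\<^sub>R v t)"
    using c[THEN integrable_circ_continuous] by (simp add: LINT_circ eq_neg_iff_add_eq_0)
qed

lemma weak_deriv_works:
  assumes "u \<in> H1"
  shows "square_integrable (weak_deriv u)" "has_weak_derivative u (weak_deriv u)"
proof -
  have "\<exists>v. square_integrable v \<and> has_weak_derivative u v"
    using assms by (simp add: H1_def)
  then have "square_integrable (weak_deriv u) \<and> has_weak_derivative u (weak_deriv u)"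
    unfolding weak_deriv_def by (rule someI_ex)
  then show "square_integrable (weak_deriv u)" "has_weak_derivative u (weak_deriv u)" by auto
qed

section \<open>Bounds of the action\<close>

lemma powr_minus_tangent:
  fixes x c g :: real
  assumes "0 < x" "0 < c" "0 < g"
  shows "c powr (- g) - g * c powr (- g - 1) * (x - c) \<le> x powr (- g)"
proof -
  have "convex_on {0<..} (\<lambda>x::real. x powr (- g))"
  proof (rule f''_ge0_imp_convex[where f' = "\<lambda>x. - g * x powr (- g - 1)" and f'' = "\<lambda>x. - g * ((- g - 1) * x powr (- g - 1 - 1))"])
    show "((\<lambda>x. x powr (- g)) has_real_derivative - g * x powr (- g - 1)) (at x)" if "x \<in> {0<..}" for x
      using that by (auto intro!: derivative_eq_intros)
    show "((\<lambda>x. - g * x powr (- g - 1)) has_real_derivative - g * ((- g - 1) * x powr (- g - 1 - 1))) (at x)"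
      if "x \<in> {0<..}" for x
      using that by (auto intro!: derivative_eq_intros)
    show "0 \<le> - g * ((- g - 1) * x powr (- g - 1 - 1))" for x
      using assms(3) by (auto simp: mult_nonneg_nonpos mult_nonpos_nonneg)
  qed auto
  then have "x powr (- g) - c powr (- g) \<ge> - g * c powr (- g - 1) * (x - c)"
  proof (rule convex_on_imp_above_tangent)
    show "((\<lambda>x. x powr (- g)) has_real_derivative - g * c powr (- g - 1)) (at c within {0<..})"
      using assms by (auto intro!: derivative_eq_intros)
  qed (use assms in \<open>auto intro!: connected_Ioi simp: interior_open\<close>)
  then show ?thesis by (simp add: algebra_simps)
qed

text \<open>Jensen's inequality, by integrating the tangent at \<open>c\<close>. The slope is
  negative, so a mean of \<open>f\<close> below \<open>c\<close> only raises the integral of the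
  tangent.\<close>

lemma integral_powr_minus_ge:
  fixes f :: "real \<Rightarrow> real"
  assumes "continuous_on UNIV f" "\<And>t. 0 < f t" "0 < c" "0 < g"
    and "integral\<^sup>L circ f \<le> 2 * pi * c"
  shows "2 * pi * c powr (- g) \<le> (LINT t|circ. f t powr (- g))"
proof -
  have f: "integrable circ f" by (rule integrable_circ_continuous[OF assms(1)])
  have k: "integrable circ (\<lambda>_. r)" for r :: real by (intro integrable_circ_continuous continuous_intros)
  have "0 \<le> g * c powr (- g - 1) * (2 * pi * c - integral\<^sup>L circ f)"
    using assms by (intro mult_nonneg_nonneg) auto
  then have "2 * pi * c powr (- g) \<le> 2 * pi * c powr (- g) - g * c powr (- g - 1) * (integral\<^sup>L circ f - 2 * pi * c)"
    by (simp add: algebra_simps)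
  also have "\<dots> = (LINT t|circ. c powr (- g) - g * c powr (- g - 1) * (f t - c))"
    using f k by simp
  also have "\<dots> \<le> (LINT t|circ. f t powr (- g))"
  proof (rule integral_mono)
    have "\<forall>t. f t \<noteq> 0" using assms(2) by (metis less_irrefl)
    then show "integrable circ (\<lambda>t. f t powr (- g))"
      by (intro integrable_circ_continuous continuous_intros assms) auto
    show "c powr (- g) - g * c powr (- g - 1) * (f t - c) \<le> f t powr (- g)" for t
      by (rule powr_minus_tangent) (use assms in auto)
  qed (use f k in auto)
  finally show ?thesis .
qed

section \<open>The reduced action and the lower bound\<close>

text \<open>The bases are the chords between the vertices of a regular polygon of radius
  \<open>1\<close>: this is its interaction potential for unit masses.\<close>

definition polygon_sum :: "nat \<Rightarrow> real \<Rightarrow> real" where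
  "polygon_sum n \<alpha> = (\<Sum>(i, j) \<in> {(i, j). 1 \<le> i \<and> i < j \<and> j \<le> n}.
     (2 * sin ((real j - real i) * pi / real n)) powr (- \<alpha>))"

text \<open>The action per \<open>2 \<pi> m\<close> of the polygon of radius \<open>r\<close> when \<open>s = r\<close>. The centers see the mean square \<open>s\<^sup>2\<close> of the
  loop, which may be smaller than the mean square \<open>r\<^sup>2\<close> of its derivative.\<close>

definition red_action :: "nat \<Rightarrow> real \<Rightarrow> real \<Rightarrow> real \<Rightarrow> real \<Rightarrow> real \<Rightarrow> real \<Rightarrow> real" where
  "red_action n \<alpha> \<beta> m M r s = real n * r\<^sup>2 / 2 + m * polygon_sum n \<alpha> * r powr (- \<alpha>)
     + 2 * real n * M * (s\<^sup>2 + 1) powr (- (\<beta> / 2))"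

lemma finite_pairs: "finite {(i, j). 1 \<le> i \<and> i < j \<and> j \<le> (n :: nat)}"
  by (rule finite_subset[of _ "{1..n} \<times> {1..n}"]) auto

lemma sin_pair_pos:
  assumes "i < j" "j \<le> n" "1 \<le> i"
  shows "0 < sin ((real j - real i) * pi / real n)"
proof (rule sin_gt_zero)
  show "0 < (real j - real i) * pi / real n" using assms by simp
  have "real j - real i < real n" using assms by linarith
  then have "(real j - real i) * pi < real n * pi" by simp
  then show "(real j - real i) * pi / real n < pi"
    using assms by (simp add: pos_divide_less_eq mult.commute)
qed

lemma polygon_sum_pos:
  assumes "2 \<le> n"
  shows "0 < polygon_sum n \<alpha>"
  unfolding polygon_sum_def
proof (rule sum_pos[OF finite_pairs])
  have "(1, 2) \<in> {(i, j). 1 \<le> i \<and> i < j \<and> j \<le> n}" using assms by auto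
  then show "{(i, j). 1 \<le> i \<and> i < j \<and> j \<le> n} \<noteq> {}" by blast
  show "0 < (case p of (i, j) \<Rightarrow> (2 * sin ((real j - real i) * pi / real n)) powr (- \<alpha>))"
    if "p \<in> {(i, j). 1 \<le> i \<and> i < j \<and> j \<le> n}" for p
    using that sin_pair_pos[of "fst p" "snd p" n] by (auto split: prod.splits)
qed

lemma square_powr_half: "0 < x \<Longrightarrow> (x\<^sup>2) powr (- (a / 2)) = x powr (- a)" for x a :: real
  by (simp add: powr_powr flip: powr_numeral)

text \<open>The available estimates concern integrals of squared norms, so Jensen needs the
  potentials as powers of these.\<close>

lemma divide_norm_powr:
  fixes x :: "'a::real_normed_vector"
  assumes "x \<noteq> 0"
  shows "a / norm x powr b = a * ((norm x)\<^sup>2) powr (- (b / 2))"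
  using square_powr_half[of "norm x" b] assms by (simp add: powr_minus_divide)

lemma integral_circ_pos:
  fixes f :: "real \<Rightarrow> real"
  assumes "continuous_on UNIV f" "\<And>t. 0 < f t"
  shows "0 < integral\<^sup>L circ f"
proof -
  have "\<exists>t0\<in>{0..2 * pi}. \<forall>t\<in>{0..2 * pi}. f t0 \<le> f t"
    by (intro continuous_attains_inf) (use continuous_on_subset[OF assms(1)] in auto)
  then obtain t0 where t0: "\<And>t. t \<in> {0..2 * pi} \<Longrightarrow> f t0 \<le> f t"
    by blast
  have "0 < 2 * pi * f t0" using assms(2) by simp
  also have "\<dots> = (LINT t|circ. f t0)" by simp
  also have "\<dots> \<le> integral\<^sup>L circ f"
    by (intro integral_mono integrable_circ_continuous continuous_intros assms t0)
      (simp add: space_restrict_space)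
  finally show ?thesis .
qed

text \<open>The integral splits because each term is integrable: the potentials are continuous by
  absence of collisions, and the weak derivatives are square integrable.\<close>

lemma action_eq:
  assumes "p \<in> collision_free_loops n"
  shows "action n \<alpha> \<beta> m M p = m / 2 * (\<Sum>i=1..n. LINT t|circ. (norm (weak_deriv (p i) t))\<^sup>2)
     + (\<Sum>(i, j) \<in> {(i, j). 1 \<le> i \<and> i < j \<and> j \<le> n}. m\<^sup>2 * (LINT t|circ. ((norm (p i t - p j t))\<^sup>2) powr (- (\<alpha> / 2))))
     + (\<Sum>i=1..n. m * M * (LINT t|circ. ((norm (p i t - C1))\<^sup>2) powr (- (\<beta> / 2)))
                  + m * M * (LINT t|circ. ((norm (p i t - C2))\<^sup>2) powr (- (\<beta> / 2))))"
proof -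
  let ?P = "{(i, j). 1 \<le> i \<and> i < j \<and> j \<le> n}"
  have H1: "p i \<in> H1" if "i \<in> {1..n}" for i
    using assms that by (simp add: collision_free_loops_def)
  have c: "continuous_on UNIV (p i)" if "i \<in> {1..n}" for i
    using H1[OF that] by (simp add: H1_def)
  have nz: "p i t - p j t \<noteq> 0" if "(i, j) \<in> ?P" for i j t
    using assms that by (auto simp: collision_free_loops_def)
  have nC: "p i t - C1 \<noteq> 0" "p i t - C2 \<noteq> 0" if "i \<in> {1..n}" for i t
    using assms that by (auto simp: collision_free_loops_def)
  have I0: "integrable circ (\<lambda>t. ((norm (g t))\<^sup>2) powr e)"
    if "continuous_on UNIV g" "\<And>t. g t \<noteq> 0" for g :: "real \<Rightarrow> point" and e
    by (intro integrable_circ_continuous continuous_intros that) (use that in auto)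
  have Iv: "integrable circ (\<lambda>t. (norm (weak_deriv (p i) t))\<^sup>2)" if "i \<in> {1..n}" for i
    using weak_deriv_works(1)[OF H1[OF that]] by (simp add: square_integrable_iff_circ)
  have Ip: "integrable circ (\<lambda>t. ((norm (p i t - p j t))\<^sup>2) powr (- (\<alpha> / 2)))" if "(i, j) \<in> ?P" for i j
    using that nz c by (intro I0 continuous_intros) auto
  have Ic: "integrable circ (\<lambda>t. ((norm (p i t - C1))\<^sup>2) powr (- (\<beta> / 2)))"
    "integrable circ (\<lambda>t. ((norm (p i t - C2))\<^sup>2) powr (- (\<beta> / 2)))" if "i \<in> {1..n}" for i
    using that nC c by (auto intro!: I0 continuous_intros)
  have V: "V n \<alpha> \<beta> m M (\<lambda>i. p i t)
      = (\<Sum>(i, j) \<in> ?P. m\<^sup>2 * ((norm (p i t - p j t))\<^sup>2) powr (- (\<alpha> / 2)))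
        + (\<Sum>i=1..n. m * M * ((norm (p i t - C1))\<^sup>2) powr (- (\<beta> / 2)) + m * M * ((norm (p i t - C2))\<^sup>2) powr (- (\<beta> / 2)))"
    for t
    unfolding V_def
    by (intro arg_cong2[where f = "(+)"] sum.cong refl)
      (auto simp only: mem_Collect_eq split_conv intro!: divide_norm_powr nz nC)
  let ?A = "\<lambda>t. m / 2 * (\<Sum>i=1..n. (norm (weak_deriv (p i) t))\<^sup>2)"
  let ?B = "\<lambda>t. \<Sum>(i, j) \<in> ?P. m\<^sup>2 * ((norm (p i t - p j t))\<^sup>2) powr (- (\<alpha> / 2))"
  let ?C = "\<lambda>t. \<Sum>i=1..n. m * M * ((norm (p i t - C1))\<^sup>2) powr (- (\<beta> / 2)) + m * M * ((norm (p i t - C2))\<^sup>2) powr (- (\<beta> / 2))"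
  have "integrable circ ?A" "integral\<^sup>L circ ?A = m / 2 * (\<Sum>i=1..n. LINT t|circ. (norm (weak_deriv (p i) t))\<^sup>2)"
    using Iv by (intro integrable_mult_right Bochner_Integration.integrable_sum, simp)
      (subst integral_mult_right_zero, subst Bochner_Integration.integral_sum, use Iv in auto)
  moreover have "integrable circ ?B" "integral\<^sup>L circ ?B
      = (\<Sum>(i, j) \<in> ?P. m\<^sup>2 * (LINT t|circ. ((norm (p i t - p j t))\<^sup>2) powr (- (\<alpha> / 2))))"
    using Ip unfolding split_def
    by (auto intro!: Bochner_Integration.integrable_sum sum.cong simp: Bochner_Integration.integral_sum)
  moreover have "integrable circ ?C" "integral\<^sup>L circ ?C
      = (\<Sum>i=1..n. m * M * (LINT t|circ. ((norm (p i t - C1))\<^sup>2) powr (- (\<beta> / 2)))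
                  + m * M * (LINT t|circ. ((norm (p i t - C2))\<^sup>2) powr (- (\<beta> / 2))))"
    using Ic by (auto intro!: Bochner_Integration.integrable_sum sum.cong simp: Bochner_Integration.integral_sum)
  moreover have "action n \<alpha> \<beta> m M p = (LINT t|circ. ?A t + (?B t + ?C t))"
    unfolding action_def V LINT_circ ..
  ultimately show ?thesis
    by simp
qed

lemma inner_point: "x \<bullet> y = x $ 1 * y $ 1 + x $ 2 * y $ 2 + x $ 3 * y $ 3" for x y :: point
  by (simp add: inner_vec_def sum_3)

lemma norm_C: "norm C1 = 1" "norm C2 = 1"
  by (simp_all add: norm_eq_1 inner_point C1_def C2_def)

text \<open>Any particle \<open>k\<close> can serve as reference in place of particle
  \<open>1\<close>.\<close>

lemma Lam_shift_eq:
  assumes "p \<in> Lam n" "i \<in> {1..n}" "k \<in> {1..n}"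
  shows "p i t = p k (t + (real i - real k) * (2 * pi / real n))"
proof -
  have "p i t = p 1 (t + (real i - 1) * (2 * pi / real n))"
    if "i \<in> {1..n}" for i t
    using assms(1) that unfolding Lam_def by blast
  from this[OF assms(2), of t] this[OF assms(3), of "t + (real i - real k) * (2 * pi / real n)"]
  show ?thesis by (simp add: algebra_simps diff_divide_distrib)
qed

text \<open>The kinetic energy and the chords are controlled by the radius \<open>r\<close> of the
  derivative, the centers by the radius \<open>s\<close> of the loop itself. Keeping both radii
  preserves the equality case, which determines the radius of a minimizer.\<close>

lemma action_lower_bound:
  assumes p: "p \<in> Lam n" and n: "2 \<le> n" and pos: "0 < \<alpha>" "0 < \<beta>" "0 < m" "0 < M"
    and s: "(LINT t|circ. (norm (p 1 t))\<^sup>2) = 2 * pi * s\<^sup>2" "0 \<le> s"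
  obtains r where "0 < r" "s \<le> r" "2 * pi * m * red_action n \<alpha> \<beta> m M r s \<le> action n \<alpha> \<beta> m M p"
proof -
  let ?P = "{(i, j). 1 \<le> i \<and> i < j \<and> j \<le> n}"
  let ?\<tau> = "2 * pi / real n"
  define K where "K i = (LINT t|circ. (norm (weak_deriv (p i) t))\<^sup>2)" for i
  have cf: "p \<in> collision_free_loops n" using p by (simp add: Lam_def)
  have H1: "p i \<in> H1" if "i \<in> {1..n}" for i
    using cf that by (simp add: collision_free_loops_def)
  have c: "continuous_on UNIV (p i)" and per: "periodic (p i)" if "i \<in> {1..n}" for i
    using H1[OF that] by (simp_all add: H1_def)
  have nz: "p i t - p j t \<noteq> 0" if "(i, j) \<in> ?P" for i j t
    using cf that by (auto simp: collision_free_loops_def)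
  have nC: "p i t - C1 \<noteq> 0" "p i t - C2 \<noteq> 0" if "i \<in> {1..n}" for i t
    using cf that by (auto simp: collision_free_loops_def)
  have mean: "integral\<^sup>L circ (p i) = 0" if "i \<in> {1..n}" for i
    using p that by (simp add: Lam_def LINT_circ)
  \<comment> \<open>all \<open>K i\<close> agree, but choosing the smallest one makes it unnecessary to prove this\<close>
  obtain k where k: "k \<in> {1..n}" "\<And>i. i \<in> {1..n} \<Longrightarrow> K k \<le> K i"
    using arg_min_if_finite[of "{1..n}" K] n by (metis atLeastAtMost_iff atLeastatMost_empty_iff finite_atLeastAtMost le_trans linorder_not_less one_le_numeral)
  have U: "(LINT t|circ. (norm (p i t))\<^sup>2) = 2 * pi * s\<^sup>2" if i: "i \<in> {1..n}" for i
  proof -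
    have 1: "1 \<in> {1..n}" using n by auto
    have "(LINT t|circ. (norm (p i t))\<^sup>2) = (LINT t|circ. (norm (p 1 (t + (real i - real 1) * ?\<tau>)))\<^sup>2)"
      using Lam_shift_eq[OF p i 1] by simp
    also have "\<dots> = (LINT t|circ. (norm (p 1 t))\<^sup>2)"
      using per[OF 1] by (intro integral_circ_shift continuous_intros c 1) (simp add: periodic_def)
    finally show ?thesis using s(1) by simp
  qed
  have sK: "2 * pi * s\<^sup>2 \<le> K k"
    using Wirtinger_inequality[OF c[OF k(1)] per[OF k(1)] mean[OF k(1)] weak_deriv_works[OF H1[OF k(1)]]] U[OF k(1)]
    by (simp add: K_def)
  have pair: "(LINT t|circ. (norm (p i t - p j t))\<^sup>2) \<le> 4 * (sin ((real j - real i) * pi / real n))\<^sup>2 * K k"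
    if ij: "(i, j) \<in> ?P" for i j
  proof -
    let ?h = "(real j - real i) * ?\<tau>"
    define G where "G t = (norm (p k (t + ?h) - p k t))\<^sup>2" for t
    have "norm (p i t - p j t) = norm (p j t - p i t)" for t by (rule norm_minus_commute)
    \<comment> \<open>Up to a time translation this is the difference of \<open>p k\<close> and its
      shift by \<open>?h\<close>; half of \<open>?h\<close> is the angle in
      \<open>polygon_sum\<close>.\<close>
    moreover have "p j t - p i t = p k (t + (real i - real k) * ?\<tau> + ?h) - p k (t + (real i - real k) * ?\<tau>)" for t
    proof -
      have e: "t + (real i - real k) * ?\<tau> + ?h = t + (real j - real k) * ?\<tau>"
        by (simp add: algebra_simps diff_divide_distrib)
      have "p l t = p k (t + (real l - real k) * ?\<tau>)" if "l \<in> {i, j}" for l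
        using ij that by (intro Lam_shift_eq[OF p _ k(1)]) auto
      from this[of i] this[of j] show ?thesis
        unfolding e by simp
    qed
    ultimately have "(LINT t|circ. (norm (p i t - p j t))\<^sup>2) = (LINT t|circ. G (t + (real i - real k) * ?\<tau>))"
      by (simp add: G_def)
    also have "\<dots> = integral\<^sup>L circ G"
    proof (rule integral_circ_shift)
      show "continuous_on UNIV G"
        unfolding G_def
        by (intro continuous_intros c[OF k(1)] continuous_on_compose2[OF c[OF k(1)]]) auto
      show "periodic G"
        using per[OF k(1)] periodic_shift[OF per[OF k(1)], of ?h] by (simp add: periodic_def G_def)
    qed
    also have "\<dots> \<le> 4 * (sin (?h / 2))\<^sup>2 * K k"
      unfolding G_def K_def
      by (rule shift_inequality[OF c[OF k(1)] per[OF k(1)] weak_deriv_works[OF H1[OF k(1)]]])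
    finally show ?thesis by simp
  qed
  \<comment> \<open>Particles \<open>1\<close> and \<open>2\<close> never meet, so the mean square
    of their difference is positive, which excludes \<open>r = 0\<close>.\<close>
  have "0 < K k"
  proof -
    have 12: "(1, 2) \<in> ?P" using n by auto
    have "0 < (LINT t|circ. (norm (p 1 t - p 2 t))\<^sup>2)"
      using nz[OF 12] n by (intro integral_circ_pos continuous_intros c) auto
    also have "\<dots> \<le> 4 * (sin ((real 2 - real 1) * pi / real n))\<^sup>2 * K k"
      by (rule pair[OF 12])
    finally show ?thesis by (simp add: zero_less_mult_iff not_less)
  qed
  define r where "r = sqrt (K k / (2 * pi))"
  have r: "0 < r" "K k = 2 * pi * r\<^sup>2"
    using \<open>0 < K k\<close> by (simp_all add: r_def)
  have "s\<^sup>2 \<le> r\<^sup>2" using sK r(2) by simp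
  then have "s \<le> r" by (rule power2_le_imp_le) (use r(1) in simp)
  have kin: "real n * (2 * pi * r\<^sup>2) \<le> (\<Sum>i=1..n. K i)"
    using sum_bounded_below[of "{1..n}" "K k" K] k(2) r(2) by simp
  have pairs: "2 * pi * ((2 * sin ((real j - real i) * pi / real n)) powr (- \<alpha>) * r powr (- \<alpha>))
      \<le> (LINT t|circ. ((norm (p i t - p j t))\<^sup>2) powr (- (\<alpha> / 2)))"
    if ij: "(i, j) \<in> ?P" for i j
  proof -
    define S where "S = sin ((real j - real i) * pi / real n)"
    have S: "0 < S" unfolding S_def using ij by (intro sin_pair_pos) auto
    have "2 * pi * ((2 * S * r)\<^sup>2) powr (- (\<alpha> / 2)) \<le> (LINT t|circ. ((norm (p i t - p j t))\<^sup>2) powr (- (\<alpha> / 2)))"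
    proof (rule integral_powr_minus_ge)
      show "continuous_on UNIV (\<lambda>t. (norm (p i t - p j t))\<^sup>2)"
        using ij by (intro continuous_intros c) auto
      show "integral\<^sup>L circ (\<lambda>t. (norm (p i t - p j t))\<^sup>2) \<le> 2 * pi * (2 * S * r)\<^sup>2"
        using pair[OF ij] r(2) by (simp add: S_def power_mult_distrib algebra_simps)
    qed (use S r(1) pos nz[OF ij] in auto)
    moreover have "((2 * S * r)\<^sup>2) powr (- (\<alpha> / 2)) = (2 * S) powr (- \<alpha>) * r powr (- \<alpha>)"
      using S r(1) square_powr_half[of "2 * S * r" \<alpha>] powr_mult[of "2 * S" r "- \<alpha>"] by simp
    ultimately show ?thesis by (simp add: S_def)
  qed
  have center: "2 * pi * (s\<^sup>2 + 1) powr (- (\<beta> / 2)) \<le> (LINT t|circ. ((norm (p i t - C))\<^sup>2) powr (- (\<beta> / 2)))"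
    if i: "i \<in> {1..n}" and C: "norm C = 1" "\<And>t. p i t - C \<noteq> 0" for i C
  proof (rule integral_powr_minus_ge)
    have I: "integrable circ (\<lambda>t. (norm (p i t))\<^sup>2)" "integrable circ (p i)" "integrable circ (\<lambda>_. 1::real)"
      by (intro integrable_circ_continuous continuous_intros c i)+
    \<comment> \<open>The mixed term is linear in \<open>p i\<close> and integrates to zero, so only
      the position-independent \<open>1\<close> is added.\<close>
    have "(norm (p i t - C))\<^sup>2 = (norm (p i t))\<^sup>2 - 2 * (p i t \<bullet> C) + 1" for t
      using C(1) by (simp add: power2_norm_eq_inner inner_diff inner_commute norm_eq_1)
    then have "(LINT t|circ. (norm (p i t - C))\<^sup>2) = (LINT t|circ. (norm (p i t))\<^sup>2 - 2 * (p i t \<bullet> C) + 1)"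
      by simp
    also have "\<dots> = 2 * pi * s\<^sup>2 - 2 * (integral\<^sup>L circ (p i) \<bullet> C) + 2 * pi"
      using I U[OF i] by simp
    finally show "(LINT t|circ. (norm (p i t - C))\<^sup>2) \<le> 2 * pi * (s\<^sup>2 + 1)"
      using mean[OF i] by (simp add: algebra_simps)
    show "0 < s\<^sup>2 + 1" by (simp add: add_nonneg_pos)
  qed (use C pos in \<open>auto intro!: continuous_intros c i\<close>)
  have "2 * pi * m * red_action n \<alpha> \<beta> m M r s
      = m / 2 * (real n * (2 * pi * r\<^sup>2))
        + (\<Sum>(i, j) \<in> ?P. m\<^sup>2 * (2 * pi * ((2 * sin ((real j - real i) * pi / real n)) powr (- \<alpha>) * r powr (- \<alpha>))))
        + (\<Sum>i=1..n. m * M * (2 * pi * (s\<^sup>2 + 1) powr (- (\<beta> / 2))) + m * M * (2 * pi * (s\<^sup>2 + 1) powr (- (\<beta> / 2))))"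
    unfolding red_action_def polygon_sum_def
    by (simp add: sum_distrib_left sum_distrib_right split_def power2_eq_square algebra_simps)
  also have "\<dots> \<le> action n \<alpha> \<beta> m M p"
    unfolding action_eq[OF cf]
  proof (intro add_mono)
    show "m / 2 * (real n * (2 * pi * r\<^sup>2)) \<le> m / 2 * (\<Sum>i=1..n. LINT t|circ. (norm (weak_deriv (p i) t))\<^sup>2)"
      using kin pos unfolding K_def by (intro mult_left_mono) auto
    have "m\<^sup>2 * (2 * pi * ((2 * sin ((real j - real i) * pi / real n)) powr (- \<alpha>) * r powr (- \<alpha>)))
        \<le> m\<^sup>2 * (LINT t|circ. ((norm (p i t - p j t))\<^sup>2) powr (- (\<alpha> / 2)))" if "(i, j) \<in> ?P" for i j
      by (rule mult_left_mono[OF pairs[OF that]]) simp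
    then show "(\<Sum>(i, j) \<in> ?P. m\<^sup>2 * (2 * pi * ((2 * sin ((real j - real i) * pi / real n)) powr (- \<alpha>) * r powr (- \<alpha>))))
        \<le> (\<Sum>(i, j) \<in> ?P. m\<^sup>2 * (LINT t|circ. ((norm (p i t - p j t))\<^sup>2) powr (- (\<alpha> / 2))))"
      unfolding split_def by (intro sum_mono) simp
    have "m * M * (2 * pi * (s\<^sup>2 + 1) powr (- (\<beta> / 2))) \<le> m * M * (LINT t|circ. ((norm (p i t - C))\<^sup>2) powr (- (\<beta> / 2)))"
      if "i \<in> {1..n}" "norm C = 1" "\<And>t. p i t - C \<noteq> 0" for i C
      by (rule mult_left_mono[OF center[OF that]]) (use pos in simp)
    then show "(\<Sum>i=1..n. m * M * (2 * pi * (s\<^sup>2 + 1) powr (- (\<beta> / 2))) + m * M * (2 * pi * (s\<^sup>2 + 1) powr (- (\<beta> / 2))))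
        \<le> (\<Sum>i=1..n. m * M * (LINT t|circ. ((norm (p i t - C1))\<^sup>2) powr (- (\<beta> / 2)))
                  + m * M * (LINT t|circ. ((norm (p i t - C2))\<^sup>2) powr (- (\<beta> / 2))))"
      using norm_C nC by (intro sum_mono add_mono) blast+
  qed
  finally show ?thesis
    using that[of r] r(1) \<open>s \<le> r\<close> by blast
qed

section \<open>The polygon rotating in the yz-plane\<close>

text \<open>With unit angular velocity the derivative and the antiderivative are the same circle
  advanced or delayed by a quarter turn.\<close>

definition yz_circle :: "real \<Rightarrow> real \<Rightarrow> point" where
  "yz_circle r t = r *\<^sub>R (cos t *\<^sub>R axis 2 1 + sin t *\<^sub>R axis 3 1)"

definition yz_polygon :: "nat \<Rightarrow> real \<Rightarrow> nat \<Rightarrow> real \<Rightarrow> point" where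
  "yz_polygon n r i t = yz_circle r (t + (real i - 1) * (2 * pi / real n))"

lemma yz_circle_nth:
  "yz_circle r t $ 1 = 0" "yz_circle r t $ 2 = r * cos t" "yz_circle r t $ 3 = r * sin t"
  by (simp_all add: yz_circle_def axis_def)

lemma yz_circle_periodic: "yz_circle r (t + 2 * pi) = yz_circle r t"
  by (simp add: yz_circle_def)

lemma continuous_on_yz_circle: "continuous_on UNIV (\<lambda>t. yz_circle r (t + a))"
  unfolding yz_circle_def by (intro continuous_intros)

lemma yz_circle_deriv:
  "((\<lambda>t. yz_circle r (t + a)) has_vector_derivative yz_circle r (t + a + pi / 2)) (at t)"
proof -
  have "((\<lambda>t. cos (t + a)) has_vector_derivative - sin (t + a)) (at t)"
    "((\<lambda>t. sin (t + a)) has_vector_derivative cos (t + a)) (at t)"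
    unfolding has_real_derivative_iff_has_vector_derivative[symmetric]
    by (auto intro!: derivative_eq_intros)
  then have "((\<lambda>t. yz_circle r (t + a)) has_vector_derivative
      r *\<^sub>R ((- sin (t + a)) *\<^sub>R axis 2 1 + cos (t + a) *\<^sub>R axis 3 1)) (at t)"
    unfolding yz_circle_def by (auto intro!: derivative_eq_intros)
  moreover have "cos (t + a + pi / 2) = - sin (t + a)" "sin (t + a + pi / 2) = cos (t + a)"
    by (simp_all add: cos_add sin_add)
  ultimately show ?thesis by (simp add: yz_circle_def)
qed

lemma norm_yz_circle: "(norm (yz_circle r t))\<^sup>2 = r\<^sup>2"
proof -
  have "(norm (yz_circle r t))\<^sup>2 = r\<^sup>2 * ((sin t)\<^sup>2 + (cos t)\<^sup>2)"
    unfolding power2_norm_eq_inner inner_point vector_minus_component yz_circle_nth by algebra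
  then show ?thesis by simp
qed

lemma norm_yz_circle_diff: "(norm (yz_circle r s - yz_circle r t))\<^sup>2 = (2 * sin ((t - s) / 2) * r)\<^sup>2"
proof -
  have "(norm (yz_circle r s - yz_circle r t))\<^sup>2 = r\<^sup>2 * ((cos s - cos t)\<^sup>2 + (sin s - sin t)\<^sup>2)"
    unfolding power2_norm_eq_inner inner_point vector_minus_component yz_circle_nth by algebra
  also have "(cos s - cos t)\<^sup>2 + (sin s - sin t)\<^sup>2 = ((sin s)\<^sup>2 + (cos s)\<^sup>2) + ((sin t)\<^sup>2 + (cos t)\<^sup>2) - 2 * cos (t - s)"
    by (simp add: cos_diff power2_eq_square algebra_simps)
  also have "\<dots> = 4 * (sin ((t - s) / 2))\<^sup>2"
  proof -
    have "2 * ((t - s) / 2) = t - s" by simp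
    then have "cos (t - s) = 1 - 2 * (sin ((t - s) / 2))\<^sup>2"
      using cos_double_sin[of "(t - s) / 2"] by (simp only:)
    then show ?thesis by simp
  qed
  finally show ?thesis by (simp add: power_mult_distrib algebra_simps)
qed

text \<open>The centers lie at distance \<open>1\<close> on the axis perpendicular to the plane of
  the circle, so the distances are constant in time.\<close>

lemma norm_yz_circle_center:
  "(norm (yz_circle r t - C1))\<^sup>2 = r\<^sup>2 + 1" "(norm (yz_circle r t - C2))\<^sup>2 = r\<^sup>2 + 1"
proof -
  have "(norm (yz_circle r t - C))\<^sup>2 = (norm (yz_circle r t))\<^sup>2 - 2 * (yz_circle r t \<bullet> C) + (norm C)\<^sup>2" for C
    by (simp add: power2_norm_eq_inner inner_diff inner_commute)
  moreover have "yz_circle r t \<bullet> C1 = 0" "yz_circle r t \<bullet> C2 = 0"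
    by (simp_all add: inner_point yz_circle_nth C1_def C2_def)
  ultimately show "(norm (yz_circle r t - C1))\<^sup>2 = r\<^sup>2 + 1" "(norm (yz_circle r t - C2))\<^sup>2 = r\<^sup>2 + 1"
    by (simp_all add: norm_yz_circle norm_C)
qed

lemma square_integrable_continuous: "continuous_on UNIV f \<Longrightarrow> square_integrable f"
  unfolding square_integrable_iff_circ
  by (auto intro!: borel_measurable_continuous_onI integrable_circ_continuous continuous_intros)

lemma yz_circle_weak_derivative:
  "has_weak_derivative (\<lambda>t. yz_circle r (t + a)) (\<lambda>t. yz_circle r (t + (a + pi / 2)))"
proof (rule has_weak_derivative_classical)
  have "periodic (\<lambda>t. yz_circle r (t + a))" for a
    by (intro periodic_shift) (simp add: periodic_def yz_circle_periodic)
  then show "periodic (\<lambda>t. yz_circle r (t + a))" "periodic (\<lambda>t. yz_circle r (t + (a + pi / 2)))" by auto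
qed (use yz_circle_deriv[of r a] in \<open>auto intro: continuous_on_yz_circle simp: add.assoc\<close>)

lemma yz_circle_H1: "(\<lambda>t. yz_circle r (t + a)) \<in> H1"
proof -
  have "periodic (\<lambda>t. yz_circle r (t + a))"
    by (intro periodic_shift) (simp add: periodic_def yz_circle_periodic)
  then show ?thesis
    unfolding H1_def using yz_circle_weak_derivative continuous_on_yz_circle square_integrable_continuous
    by blast
qed

lemma yz_polygon_H1: "yz_polygon n r i \<in> H1"
  unfolding yz_polygon_def[abs_def] by (rule yz_circle_H1)

lemma yz_polygon_diff:
  "(norm (yz_polygon n r i t - yz_polygon n r j t))\<^sup>2 = (2 * sin ((real j - real i) * pi / real n) * r)\<^sup>2"
proof -
  have "(t + (real j - 1) * (2 * pi / real n) - (t + (real i - 1) * (2 * pi / real n))) / 2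
      = (real j - real i) * pi / real n"
    by (simp add: field_simps diff_divide_distrib)
  then show ?thesis
    unfolding yz_polygon_def norm_yz_circle_diff by simp
qed

lemma yz_polygon_collision_free:
  assumes "0 < r"
  shows "yz_polygon n r \<in> collision_free_loops n"
  unfolding collision_free_loops_def
proof (intro CollectI conjI ballI allI impI)
  have neq: "yz_polygon n r i t \<noteq> yz_polygon n r j t" if "1 \<le> i" "i < j" "j \<le> n" for i j t
    using yz_polygon_diff[of n r i t j] sin_pair_pos[of i j n] that assms by auto
  then show "yz_polygon n r i t \<noteq> yz_polygon n r j t" if "i \<in> {1..n}" "j \<in> {1..n}" "i \<noteq> j" for i j t
    using that neq[of i j t] neq[of j i t] by (cases "i < j") force+
  have "r\<^sup>2 + 1 \<noteq> 0" by (smt (verit) zero_le_power2)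
  then show "yz_polygon n r i t \<noteq> C1" "yz_polygon n r i t \<noteq> C2" for i t
    using norm_yz_circle_center[of r "t + (real i - 1) * (2 * pi / real n)"]
    by (auto simp: yz_polygon_def)
qed (rule yz_polygon_H1)

lemma yz_polygon_Lam:
  assumes "0 < r"
  shows "yz_polygon n r \<in> Lam n"
  unfolding Lam_def
proof (intro CollectI conjI ballI allI yz_polygon_collision_free assms)
  fix i
  have "(LINT t|circ. yz_polygon n r i t) = 0"
  proof (rule integral_circ_periodic_deriv)
    let ?a = "(real i - 1) * (2 * pi / real n)"
    \<comment> \<open>The antiderivative is the circle delayed by a quarter turn; being periodic, it
      forces the mean to vanish.\<close>
    show "((\<lambda>t. yz_circle r (t + (?a - pi / 2))) has_vector_derivative yz_polygon n r i t) (at t)" for t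
      using yz_circle_deriv[of r "?a - pi / 2" t] by (simp add: yz_polygon_def)
    show "continuous_on UNIV (yz_polygon n r i)" "periodic (\<lambda>t. yz_circle r (t + (?a - pi / 2)))"
      using yz_polygon_H1 yz_circle_H1 by (simp_all add: H1_def)
  qed
  then show "(LINT t:{0..2 * pi}|lborel. yz_polygon n r i t) = 0" by (simp add: LINT_circ)
qed (simp add: yz_polygon_def)

text \<open>All distances are constant in time, and so is the speed \<open>r\<close> of an explicit
  weak derivative, which may replace \<open>weak_deriv\<close> under the integral.\<close>

lemma action_yz_polygon:
  assumes "0 < r"
  shows "action n \<alpha> \<beta> m M (yz_polygon n r) = 2 * pi * m * red_action n \<alpha> \<beta> m M r r"
proof -
  let ?P = "{(i, j). 1 \<le> i \<and> i < j \<and> j \<le> n}"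
  have K: "(LINT t|circ. (norm (weak_deriv (yz_polygon n r i) t))\<^sup>2) = 2 * pi * r\<^sup>2" for i
  proof -
    let ?a = "(real i - 1) * (2 * pi / real n)"
    have "(LINT t|circ. (norm (weak_deriv (yz_polygon n r i) t))\<^sup>2) = (LINT t|circ. (norm (yz_circle r (t + (?a + pi / 2))))\<^sup>2)"
    proof (rule weak_derivative_norm_unique)
      show "has_weak_derivative (yz_polygon n r i) (\<lambda>t. yz_circle r (t + (?a + pi / 2)))"
        unfolding yz_polygon_def[abs_def] by (rule yz_circle_weak_derivative)
      show "continuous_on UNIV (yz_polygon n r i)"
        unfolding yz_polygon_def[abs_def] by (rule continuous_on_yz_circle)
    qed (intro weak_deriv_works yz_polygon_H1 square_integrable_continuous continuous_on_yz_circle)+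
    then show ?thesis by (simp add: norm_yz_circle)
  qed
  have P: "(LINT t|circ. ((norm (yz_polygon n r i t - yz_polygon n r j t))\<^sup>2) powr (- (\<alpha> / 2)))
      = 2 * pi * ((2 * sin ((real j - real i) * pi / real n)) powr (- \<alpha>) * r powr (- \<alpha>))"
    if ij: "(i, j) \<in> ?P" for i j
  proof -
    define S where "S = sin ((real j - real i) * pi / real n)"
    have S: "0 < S" unfolding S_def using ij by (intro sin_pair_pos) auto
    have "((2 * S * r)\<^sup>2) powr (- (\<alpha> / 2)) = (2 * S) powr (- \<alpha>) * r powr (- \<alpha>)"
      using S assms square_powr_half[of "2 * S * r" \<alpha>] powr_mult[of "2 * S" r "- \<alpha>"] by simp
    then show ?thesis by (simp add: yz_polygon_diff S_def)
  qed
  have C: "(LINT t|circ. ((norm (yz_polygon n r i t - C1))\<^sup>2) powr (- (\<beta> / 2))) = 2 * pi * (r\<^sup>2 + 1) powr (- (\<beta> / 2))"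
    "(LINT t|circ. ((norm (yz_polygon n r i t - C2))\<^sup>2) powr (- (\<beta> / 2))) = 2 * pi * (r\<^sup>2 + 1) powr (- (\<beta> / 2))" for i
    by (simp_all add: yz_polygon_def norm_yz_circle_center)
  have "(\<Sum>(i, j) \<in> ?P. m\<^sup>2 * (LINT t|circ. ((norm (yz_polygon n r i t - yz_polygon n r j t))\<^sup>2) powr (- (\<alpha> / 2))))
      = (\<Sum>(i, j) \<in> ?P. m\<^sup>2 * (2 * pi * ((2 * sin ((real j - real i) * pi / real n)) powr (- \<alpha>) * r powr (- \<alpha>))))"
    using P by (intro sum.cong) auto
  then show ?thesis
    unfolding action_eq[OF yz_polygon_collision_free[OF assms]] K C red_action_def polygon_sum_def
    by (simp add: sum_distrib_left sum_distrib_right split_def power2_eq_square algebra_simps)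
qed

lemma yz_polygon_relative_equilibrium:
  assumes "0 < r" "2 \<le> n"
  shows "relative_equilibrium n (yz_polygon n r)" "centered_yz_ngon_motion n r (yz_polygon n r)"
proof -
  let ?e2 = "axis 2 1 :: point" and ?e3 = "axis 3 1 :: point"
  have on: "orthonormal_pair (cos t *\<^sub>R ?e2 + sin t *\<^sub>R ?e3) (- sin t *\<^sub>R ?e2 + cos t *\<^sub>R ?e3)" for t
    by (simp add: orthonormal_pair_def norm_eq_1 inner_point axis_def flip: power2_eq_square)
  have ngon: "regular_ngon n 0 r ((\<lambda>i. yz_polygon n r i t) ` {1..n})" for t
    unfolding regular_ngon_def
  proof (intro conjI exI)
    \<comment> \<open>The frame at time \<open>t\<close> is the standard one turned by
      \<open>t\<close>. Particles are counted from \<open>1\<close> and vertices from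
      \<open>0\<close>, so vertex \<open>k\<close> is particle \<open>Suc k\<close>.\<close>
    show "(\<lambda>i. yz_polygon n r i t) ` {1..n} = (\<lambda>k. 0 + r *\<^sub>R (cos (2 * pi * real k / real n) *\<^sub>R (cos t *\<^sub>R ?e2 + sin t *\<^sub>R ?e3)
        + sin (2 * pi * real k / real n) *\<^sub>R (- sin t *\<^sub>R ?e2 + cos t *\<^sub>R ?e3))) ` {..<n}"
      (is "_ = ?f ` _")
    proof -
      have "{1..n} = Suc ` {..<n}"
        by (simp add: image_Suc_lessThan)
      moreover have "yz_polygon n r (Suc k) t = ?f k" for k
      proof -
        have "(real (Suc k) - 1) * (2 * pi / real n) = 2 * pi * real k / real n" by simp
        then show ?thesis
          unfolding yz_polygon_def yz_circle_def
          by (simp only: cos_add sin_add) (simp add: algebra_simps)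
      qed
      ultimately show ?thesis by (simp add: image_image)
    qed
  qed (use assms on in auto)
  show "centered_yz_ngon_motion n r (yz_polygon n r)"
    unfolding centered_yz_ngon_motion_def using ngon
    by (auto simp: yz_plane_def yz_polygon_def yz_circle_nth)
  show "relative_equilibrium n (yz_polygon n r)"
    unfolding relative_equilibrium_def
  proof (intro exI conjI)
    show "orthonormal_pair (cos 0 *\<^sub>R ?e2 + sin 0 *\<^sub>R ?e3) (- sin 0 *\<^sub>R ?e2 + cos 0 *\<^sub>R ?e3)" by (rule on)
    show "\<forall>t. regular_ngon n 0 r ((\<lambda>i. yz_polygon n r i t) ` {1..n})" using ngon by blast
    show "\<forall>i\<in>{1..n}. \<forall>t. yz_polygon n r i t = 0 + r *\<^sub>R
      (cos (1 * t + (\<lambda>i. (real i - 1) * (2 * pi / real n)) i) *\<^sub>R (cos 0 *\<^sub>R ?e2 + sin 0 *\<^sub>R ?e3)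
       + sin (1 * t + (\<lambda>i. (real i - 1) * (2 * pi / real n)) i) *\<^sub>R (- sin 0 *\<^sub>R ?e2 + cos 0 *\<^sub>R ?e3))"
      by (simp add: yz_polygon_def yz_circle_def)
  qed simp
qed

lemma norm_centered_ngon:
  assumes "centered_yz_ngon_motion n R q" "i \<in> {1..n}"
  shows "0 < R" "(norm (q i t))\<^sup>2 = R\<^sup>2"
proof -
  from assms(1) have "regular_ngon n 0 R ((\<lambda>i. q i t) ` {1..n})"
    by (simp add: centered_yz_ngon_motion_def)
  then obtain u v where R: "0 < R" and uv: "orthonormal_pair u v" and
    im: "(\<lambda>i. q i t) ` {1..n} = (\<lambda>k. 0 + R *\<^sub>R (cos (2 * pi * real k / real n) *\<^sub>R u
                        + sin (2 * pi * real k / real n) *\<^sub>R v)) ` {..<n}"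
    unfolding regular_ngon_def by blast
  show "0 < R" by (rule R)
  have "q i t \<in> (\<lambda>i. q i t) ` {1..n}" using assms(2) by blast
  then obtain x where q: "q i t = R *\<^sub>R (cos x *\<^sub>R u + sin x *\<^sub>R v)"
    unfolding im by auto
  have "u \<bullet> u = 1" "v \<bullet> v = 1" "u \<bullet> v = 0" "v \<bullet> u = 0"
    using uv by (auto simp: orthonormal_pair_def norm_eq_1 inner_commute)
  then have "(norm (q i t))\<^sup>2 = R\<^sup>2 * ((sin x)\<^sup>2 + (cos x)\<^sup>2)"
    unfolding q power2_norm_eq_inner inner_add_left inner_add_right inner_scaleR_left inner_scaleR_right
    by algebra
  then show "(norm (q i t))\<^sup>2 = R\<^sup>2" by simp
qed

section \<open>Minimizers of the reduced action and their dependence on the mass\<close>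

text \<open>The kinetic term grows at infinity and the interaction blows up at \<open>0\<close>, so
  outside \<open>{a..C}\<close> the value is at least the value \<open>C\<close> at radius
  \<open>1\<close>, and compactness does the rest.\<close>

lemma red_action_attains_min:
  assumes n: "2 \<le> n" and pos: "0 < \<alpha>" "0 < m" "0 < M"
  obtains r where "0 < r" "\<And>x. 0 < x \<Longrightarrow> red_action n \<alpha> \<beta> m M r r \<le> red_action n \<alpha> \<beta> m M x x"
proof -
  let ?f = "\<lambda>x. red_action n \<alpha> \<beta> m M x x"
  define S where "S = m * polygon_sum n \<alpha>"
  define C where "C = ?f 1"
  have S: "0 < S" using polygon_sum_pos[OF n] pos by (simp add: S_def)
  have lb: "x\<^sup>2 \<le> ?f x" "S * x powr (- \<alpha>) \<le> ?f x" if "0 < x" for x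
  proof -
    have "2 * x\<^sup>2 \<le> real n * x\<^sup>2" using n by (intro mult_right_mono) auto
    moreover have "0 \<le> S * x powr (- \<alpha>)" "0 \<le> 2 * real n * M * (x\<^sup>2 + 1) powr (- (\<beta> / 2))" "0 \<le> x\<^sup>2"
      using S pos by auto
    ultimately show "x\<^sup>2 \<le> ?f x" "S * x powr (- \<alpha>) \<le> ?f x"
      unfolding red_action_def S_def[symmetric] by linarith+
  qed
  have C: "1 \<le> C" using lb(1)[of 1] by (simp add: C_def)
  \<comment> \<open>The second entry solves \<open>S * x powr (- \<alpha>) = C\<close>; the minimum
    with \<open>1\<close> keeps the comparison radius \<open>1\<close> in the interval. The right
    end \<open>C\<close> suffices because \<open>C < x\<close> and \<open>1 \<le> C\<close> give
    \<open>C \<le> x\<^sup>2\<close>.\<close>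
  define a where "a = min 1 ((C / S) powr (- (1 / \<alpha>)))"
  have a: "0 < a" "a \<le> 1" using C S by (auto simp: a_def)
  have "continuous_on {a..C} ?f"
    unfolding red_action_def using a by (intro continuous_intros) (auto simp: add_nonneg_eq_0_iff)
  then obtain r where r: "r \<in> {a..C}" "\<And>x. x \<in> {a..C} \<Longrightarrow> ?f r \<le> ?f x"
    using continuous_attains_inf[of "{a..C}" ?f] a C by fastforce
  show ?thesis
  proof
    show "0 < r" using a r(1) by simp
    fix x :: real assume x: "0 < x"
    have rC: "?f r \<le> C" using r(2)[of 1] a C by (simp add: C_def)
    consider "x < a" | "x \<in> {a..C}" | "C < x" by fastforce
    then show "?f r \<le> ?f x"
    proof cases
      case 1
      have "a \<le> (C / S) powr (- (1 / \<alpha>))" by (simp add: a_def)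
      then have "((C / S) powr (- (1 / \<alpha>))) powr (- \<alpha>) \<le> x powr (- \<alpha>)"
        using 1 x pos by (intro powr_mono2') auto
      then have "C / S \<le> x powr (- \<alpha>)"
        using pos C S by (simp add: powr_powr)
      then show ?thesis using rC lb(2)[OF x] S by (simp add: field_simps)
    next
      case 2
      then show ?thesis by (rule r(2))
    next
      case 3
      then have "C * 1 \<le> x * x" using C by (intro mult_mono) auto
      then show ?thesis using rC lb(1)[OF x] by (simp add: power2_eq_square)
    qed
  qed
qed

text \<open>The lower bound at \<open>(r, R)\<close> is at most the action of every rotating
  polygon. If \<open>R < r\<close>, the polygon of radius \<open>r\<close> would lie strictly below
  it, since the center term strictly decreases. Hence \<open>R = r\<close>.\<close>

lemma minimizer_radius:
  assumes q: "is_minimizer n \<alpha> \<beta> m M q" "centered_yz_ngon_motion n R q"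
    and n: "2 \<le> n" and pos: "0 < \<alpha>" "0 < \<beta>" "0 < m" "0 < M" and x: "0 < x"
  shows "red_action n \<alpha> \<beta> m M R R \<le> red_action n \<alpha> \<beta> m M x x"
proof -
  have 1: "1 \<in> {1..n}" using n by simp
  have R: "0 < R" "\<And>t. (norm (q 1 t))\<^sup>2 = R\<^sup>2"
    using norm_centered_ngon[OF q(2) 1] by auto
  have up: "action n \<alpha> \<beta> m M q \<le> 2 * pi * m * red_action n \<alpha> \<beta> m M x x" if "0 < x" for x
    using q(1) yz_polygon_Lam[OF that] action_yz_polygon[OF that] by (metis is_minimizer_def)
  have "q \<in> Lam n" using q(1) by (simp add: is_minimizer_def)
  moreover have "(LINT t|circ. (norm (q 1 t))\<^sup>2) = 2 * pi * R\<^sup>2" unfolding R(2) by simp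
  ultimately obtain r where r: "0 < r" "R \<le> r" "2 * pi * m * red_action n \<alpha> \<beta> m M r R \<le> action n \<alpha> \<beta> m M q"
    using action_lower_bound[OF _ n pos _ less_imp_le[OF R(1)]] by blast
  have le: "red_action n \<alpha> \<beta> m M r R \<le> red_action n \<alpha> \<beta> m M x x" if "0 < x" for x
  proof -
    have "2 * pi * m * red_action n \<alpha> \<beta> m M r R \<le> 2 * pi * m * red_action n \<alpha> \<beta> m M x x"
      using order_trans[OF r(3) up[OF that]] .
    then show ?thesis using pos by simp
  qed
  have "R = r"
  proof (rule ccontr)
    assume "R \<noteq> r"
    then have "R\<^sup>2 + 1 < r\<^sup>2 + 1" using r R(1) by (simp add: power_strict_mono)
    then have "(r\<^sup>2 + 1) powr (- (\<beta> / 2)) < (R\<^sup>2 + 1) powr (- (\<beta> / 2))"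
      using pos by (intro powr_less_mono2_neg) (auto simp: add_nonneg_pos)
    then have "red_action n \<alpha> \<beta> m M r r < red_action n \<alpha> \<beta> m M r R"
      using n pos by (simp add: red_action_def)
    then show False using le[OF r(1)] by simp
  qed
  then show ?thesis using le[OF x] by simp
qed

text \<open>Adding the two minimality inequalities gives \<open>R \<le> R'\<close>. If
  \<open>R = R'\<close>, both functions have derivative zero there, although their derivatives
  differ by that of \<open>S * x powr (- \<alpha>)\<close>, which is nonzero.\<close>

lemma red_action_min_strict_mono:
  assumes n: "2 \<le> n" and pos: "0 < \<alpha>" and m: "m < m'" and R: "0 < R" "0 < R'"
    and min: "\<And>x. 0 < x \<Longrightarrow> red_action n \<alpha> \<beta> m M R R \<le> red_action n \<alpha> \<beta> m M x x"
    and min': "\<And>x. 0 < x \<Longrightarrow> red_action n \<alpha> \<beta> m' M R' R' \<le> red_action n \<alpha> \<beta> m' M x x"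
  shows "R < R'"
proof -
  define S where "S = (m' - m) * polygon_sum n \<alpha>"
  have S: "0 < S" using polygon_sum_pos[OF n] m by (simp add: S_def)
  have diff: "red_action n \<alpha> \<beta> m' M x x = red_action n \<alpha> \<beta> m M x x + S * x powr (- \<alpha>)" for x
    by (simp add: red_action_def S_def algebra_simps)
  have "S * R' powr (- \<alpha>) \<le> S * R powr (- \<alpha>)"
    using min[OF R(2)] min'[OF R(1)] diff[of R] diff[of R'] by linarith
  then have "R' powr (- \<alpha>) \<le> R powr (- \<alpha>)" using S by simp
  then have "R \<le> R'" using powr_less_mono2_neg[of "- \<alpha>" R' R] pos R by force
  moreover have "R \<noteq> R'"
  proof
    assume eq: "R = R'"
    have "\<exists>D. ((\<lambda>x. red_action n \<alpha> \<beta> m M x x) has_real_derivative D) (at R)"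
      unfolding red_action_def
      by (rule exI) (use R(1) in \<open>auto intro!: derivative_eq_intros simp: add_nonneg_pos\<close>)
    then obtain D where D: "((\<lambda>x. red_action n \<alpha> \<beta> m M x x) has_real_derivative D) (at R)" by blast
    have "D = 0"
      by (rule DERIV_local_min[OF D R(1)]) (use R(1) in \<open>auto intro!: min\<close>)
    have D': "((\<lambda>x. red_action n \<alpha> \<beta> m' M x x) has_real_derivative D + S * (- \<alpha> * R powr (- \<alpha> - 1))) (at R)"
      unfolding diff by (rule DERIV_add[OF D DERIV_cmult]) (use R(1) in \<open>auto intro!: derivative_eq_intros\<close>)
    have "D + S * (- \<alpha> * R powr (- \<alpha> - 1)) = 0"
      by (rule DERIV_local_min[OF D' R(1)]) (use R(1) eq in \<open>auto intro!: min'\<close>)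
    then show False using \<open>D = 0\<close> S pos R(1) by simp
  qed
  ultimately show ?thesis by simp
qed

theorem theorem1p1:
  fixes n :: nat and \<alpha> \<beta> M :: real
  assumes "n \<ge> 2" and "\<alpha> > 0" and "\<beta> > 0" and "M > 0"
  shows "(\<forall>m>0. \<exists>q R. is_minimizer n \<alpha> \<beta> m M q \<and> relative_equilibrium n q \<and>
             centered_yz_ngon_motion n R q) \<and>
         (\<forall>m m' q q' R R'. 0 < m \<and> m < m' \<and>
             is_minimizer n \<alpha> \<beta> m M q \<and> relative_equilibrium n q \<and>
             centered_yz_ngon_motion n R q \<and>
             is_minimizer n \<alpha> \<beta> m' M q' \<and> relative_equilibrium n q' \<and>
             centered_yz_ngon_motion n R' q' \<longrightarrow> R < R')"
proof (intro conjI allI impI)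
  fix m :: real assume m: "0 < m"
  obtain R where R: "0 < R" "\<And>x. 0 < x \<Longrightarrow> red_action n \<alpha> \<beta> m M R R \<le> red_action n \<alpha> \<beta> m M x x"
    using red_action_attains_min[OF assms(1,2) m assms(4)] by metis
  have "action n \<alpha> \<beta> m M (yz_polygon n R) \<le> action n \<alpha> \<beta> m M p" if p: "p \<in> Lam n" for p
  proof -
    \<comment> \<open>The root mean square of the loop, the form in which
      \<open>action_lower_bound\<close> expects it.\<close>
    define s where "s = sqrt ((LINT t|circ. (norm (p 1 t))\<^sup>2) / (2 * pi))"
    have "0 \<le> (LINT t|circ. (norm (p 1 t))\<^sup>2)" by (rule integral_nonneg_AE) simp
    then have s: "(LINT t|circ. (norm (p 1 t))\<^sup>2) = 2 * pi * s\<^sup>2" "0 \<le> s"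
      by (simp_all add: s_def)
    obtain r where r: "0 < r" "s \<le> r" "2 * pi * m * red_action n \<alpha> \<beta> m M r s \<le> action n \<alpha> \<beta> m M p"
      using action_lower_bound[OF p assms(1,2,3) m assms(4) s] by blast
    \<comment> \<open>Raising \<open>s\<close> to \<open>r\<close> only lowers the center term and
      leads to the action of an actual polygon.\<close>
    have "(r\<^sup>2 + 1) powr (- (\<beta> / 2)) \<le> (s\<^sup>2 + 1) powr (- (\<beta> / 2))"
      using s(2) r(2) assms(3) by (intro powr_mono2') (auto simp: add_nonneg_pos power_mono)
    then have "red_action n \<alpha> \<beta> m M r r \<le> red_action n \<alpha> \<beta> m M r s"
      using assms(1,4) unfolding red_action_def by (intro add_left_mono mult_left_mono) auto
    then have "red_action n \<alpha> \<beta> m M R R \<le> red_action n \<alpha> \<beta> m M r s"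
      using R(2)[OF r(1)] by simp
    then have "2 * pi * m * red_action n \<alpha> \<beta> m M R R \<le> 2 * pi * m * red_action n \<alpha> \<beta> m M r s"
      using m by (intro mult_left_mono) auto
    then show ?thesis
      unfolding action_yz_polygon[OF R(1)] using r(3) by (rule order_trans)
  qed
  then have "is_minimizer n \<alpha> \<beta> m M (yz_polygon n R)"
    using yz_polygon_Lam[OF R(1)] by (simp add: is_minimizer_def)
  then show "\<exists>q R. is_minimizer n \<alpha> \<beta> m M q \<and> relative_equilibrium n q \<and> centered_yz_ngon_motion n R q"
    using yz_polygon_relative_equilibrium[OF R(1) assms(1)] by blast
next
  fix m m' q q' R R'
  assume H: "0 < m \<and> m < m' \<and>
             is_minimizer n \<alpha> \<beta> m M q \<and> relative_equilibrium n q \<and>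
             centered_yz_ngon_motion n R q \<and>
             is_minimizer n \<alpha> \<beta> m' M q' \<and> relative_equilibrium n q' \<and>
             centered_yz_ngon_motion n R' q'"
  show "R < R'"
  proof (rule red_action_min_strict_mono[where n = n and \<alpha> = \<alpha> and \<beta> = \<beta> and M = M and m = m and m' = m'])
    show "0 < R" "0 < R'"
      using H norm_centered_ngon(1)[of n _ _ 1] assms(1) by auto
    show "red_action n \<alpha> \<beta> m M R R \<le> red_action n \<alpha> \<beta> m M x x" if "0 < x" for x
      using minimizer_radius[OF _ _ assms(1-3) _ assms(4) that, of m q R] H by blast
    show "red_action n \<alpha> \<beta> m' M R' R' \<le> red_action n \<alpha> \<beta> m' M x x" if "0 < x" for x
      using minimizer_radius[OF _ _ assms(1-3) _ assms(4) that, of m' q' R'] H by auto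
  qed (use assms H in auto)
qed

end
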